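(* Let $(\boldsymbol{u}_h,p_h)\in X_h\times M_h$ be the solution of the discrete Darcy--Forchheimer problem: for all $\boldsymbol{v}\in X_h$ and $q\in M_h$, $$\frac{\mu}{\rho}\int_\Omega \boldsymbol{K}^{-1}\boldsymbol{u}_h\cdot\boldsymbol{v}\,dx+\frac{\beta}{\rho}\int_\Omega|\boldsymbol{u}_h|\boldsymbol{u}_h\cdot\boldsymbol{v}\,dx-\int_\Omega p_h\operatorname{div}\boldsymbol{v}\,dx=\int_\Omega\boldsymbol{f}\cdot\boldsymbol{v}\,dx,\qquad \int_\Omega q\operatorname{div}\boldsymbol{u}_h\,dx=\int_\Omega gq\,dx .$$ Given $\epsilon>0$ and $p_h^{(0)}\in M_h$, let $\{(\boldsymbol{u}_h^{(n)},p_h^{(n)})\}$ be the sequence generated by the augmented Lagrangian method: for $n=0,1,2,\dots$, $$\boldsymbol{u}_h^{(n+1)}=\operatorname*{arg\,min}_{\boldsymbol{v}\in X_h}\Big\{F(\boldsymbol{v})-\int_\Omega p_h^{(n)}\operatorname{div}\boldsymbol{v}\,dx+\frac1{2\epsilon}\int_\Omega(\operatorname{div}\boldsymbol{v}-g_h)^2\,dx\Big\},\qquad p_h^{(n+1)}=p_h^{(n)}-\epsilon^{-1}(\operatorname{div}\boldsymbol{u}_h^{(n+1)}-g_h).$$ Then there exists a constant $\mu_*>0$, independent of $\epsilon$, such that for all $n\ge 0$, $$D_F^{\mathrm{sym}}(\boldsymbol{u}_h^{(n+1)},\boldsymbol{u}_h)\le\frac{\epsilon}{4}\|p_h^{(n)}-p_h\|_{L^2(\Omega)}^2\le\frac{\epsilon}{4}\Big(\frac{\epsilon}{\mu_*+\epsilon}\Big)^{2n}\|p_h^{(0)}-p_h\|_{L^2(\Omega)}^2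 .$$
   Context: $\Omega\subset\mathbb{R}^d$, $d\in\{2,3\}$, is a bounded polyhedral domain. The data are: the viscosity $\mu>0$, the density $\rho>0$, the Forchheimer coefficient $\beta\ge 0$, the permeability tensor $\boldsymbol{K}$ (symmetric, with $\boldsymbol{K}$ and $\boldsymbol{K}^{-1}$ bounded and uniformly positive definite on $\Omega$), a body force $\boldsymbol{f}$ (such that $\boldsymbol{v}\mapsto\int_\Omega\boldsymbol{f}\cdot\boldsymbol{v}\,dx$ is a bounded linear functional on $X$), and a source $g\in L^2(\Omega)$. Spaces: $X=\{\boldsymbol{v}\in L^3(\Omega)^d:\operatorname{div}\boldsymbol{v}\in L^2(\Omega)\}$ and $M=L^2(\Omega)$. $X_h\times M_h\subset X\times M$ is a (finite-dimensional) Raviart--Thomas-type conforming mixed finite element space on a quasi-uniform partition $\mathcal{T}_h$ of $\Omega$; e.g. for $d=2$ and rectangular elements $T$, the local spaces are $X_h(T)=Q_{k+1,k}(T)\oplus Q_{k,k+1}(T)$, $M_h(T)=Q_{k,k}(T)$ with $k\ge0$, where $Q_{k,\ell}(T)$ is the space of polynomials of degree at most $k$ in the first and at most $\ell$ in the second variable. As is standard for such pairs, $\operatorname{div}X_h=M_h$, and the discrete problem has a unique solution. No boundary condition is imposed on the velocity space (the boundary condition is $p=0$ on $\partial\Omega$, imposed naturally). $g_h$ is the $L^2(\Omega)$-orthogonal projection of $g$ onto $M_h$, and $$F(\boldsymbol{v})=\frac{\mu}{2\rho}\int_\Omega\boldsymbol{K}^{-1}\boldsymbol{v}\cdot\boldsymbol{v}\,dx+\frac{\beta}{3\rho}\int_\Omega|\boldsymbol{v}|^3\,dx-\int_\Omega\boldsymbol{f}\cdot\boldsymbol{v}\,dx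 .$$ Symmetrized Bregman divergence on $X_h$: $D_F^{\mathrm{sym}}(\boldsymbol{v},\boldsymbol{w})=\langle F'(\boldsymbol{v})-F'(\boldsymbol{w}),\boldsymbol{v}-\boldsymbol{w}\rangle$, where $F'$ is the Gâteaux derivative of $F$ on $X_h$ and $\langle\cdot,\cdot\rangle$ the duality pairing. "Independent of $\epsilon$" means that, with all other data (including $p_h^{(0)}$) fixed, the same $\mu_*$ works for every $\epsilon>0$. *)

theory Defs
  imports "HOL-Analysis.Analysis"
begin

section \<open>Domain and partition\<close>

definition polyhedral_domain :: "(real ^ 'd) set \<Rightarrow> bool" where
  "polyhedral_domain \<Omega> \<longleftrightarrow>
     open \<Omega> \<and> connected \<Omega> \<and> \<Omega> \<noteq> {} \<and>
     (\<exists>\<P>. finite \<P> \<and> (\<forall>P\<in>\<P>. polytope P) \<and> frontier \<Omega> = \<Union>\<P>)"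

definition partition_of_domain :: "(real ^ 'd) set \<Rightarrow> (real ^ 'd) set set \<Rightarrow> bool" where
  "partition_of_domain \<Omega> \<T> \<longleftrightarrow>
     finite \<T> \<and> \<Union>\<T> = closure \<Omega> \<and>
     (\<forall>T\<in>\<T>. polytope T \<and> interior T \<noteq> {} \<and> interior T \<subseteq> \<Omega>) \<and>
     (\<forall>S\<in>\<T>. \<forall>T\<in>\<T>. S \<noteq> T \<longrightarrow> interior S \<inter> interior T = {})"

text \<open>Every element contains a ball whose radius is comparable, with constant \<open>\<sigma>\<close>, to the
  global mesh size; this expresses shape regularity together with comparability of all
  element diameters.\<close>

definition quasi_uniform :: "real \<Rightarrow> (real ^ 'd) set set \<Rightarrow> bool" where
  "quasi_uniform \<sigma> \<T> \<longleftrightarrow>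
     \<sigma> > 0 \<and> (\<forall>T\<in>\<T>. \<exists>x. cball x (\<sigma> * Max (diameter ` \<T>)) \<subseteq> T)"


section \<open>Function spaces\<close>

text \<open>Elements of Lebesgue spaces are represented by functions; only their values almost
  everywhere in \<open>\<Omega>\<close> matter.\<close>

definition L2_space :: "(real ^ 'd) set \<Rightarrow> (real ^ 'd \<Rightarrow> real) set" where
  "L2_space \<Omega> = {q. q \<in> borel_measurable (lebesgue_on \<Omega>) \<and>
                     integrable (lebesgue_on \<Omega>) (\<lambda>x. (q x)\<^sup>2)}"

definition L2_norm :: "(real ^ 'd) set \<Rightarrow> (real ^ 'd \<Rightarrow> real) \<Rightarrow> real" where
  "L2_norm \<Omega> q = sqrt (LINT x|lebesgue_on \<Omega>. (q x)\<^sup>2)"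

definition L3_space :: "(real ^ 'd) set \<Rightarrow> (real ^ 'd \<Rightarrow> real ^ 'd) set" where
  "L3_space \<Omega> = {v. v \<in> borel_measurable (lebesgue_on \<Omega>) \<and>
                     integrable (lebesgue_on \<Omega>) (\<lambda>x. norm (v x) ^ 3)}"

definition L3_norm :: "(real ^ 'd) set \<Rightarrow> (real ^ 'd \<Rightarrow> real ^ 'd) \<Rightarrow> real" where
  "L3_norm \<Omega> v = root 3 (LINT x|lebesgue_on \<Omega>. norm (v x) ^ 3)"

definition grad :: "(real ^ 'd \<Rightarrow> real) \<Rightarrow> real ^ 'd \<Rightarrow> real ^ 'd" where
  "grad \<phi> x = (\<chi> i. frechet_derivative \<phi> (at x) (axis i 1))"

primrec Ck :: "nat \<Rightarrow> (real ^ 'd \<Rightarrow> real) \<Rightarrow> bool" where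
  "Ck 0 \<phi> \<longleftrightarrow> continuous_on UNIV \<phi>"
| "Ck (Suc k) \<phi> \<longleftrightarrow> (\<forall>x. \<phi> differentiable (at x)) \<and> (\<forall>i. Ck k (\<lambda>x. grad \<phi> x $ i))"

definition test_function :: "(real ^ 'd) set \<Rightarrow> (real ^ 'd \<Rightarrow> real) \<Rightarrow> bool" where
  "test_function \<Omega> \<phi> \<longleftrightarrow>
     (\<forall>k. Ck k \<phi>) \<and> compact (closure {x. \<phi> x \<noteq> 0}) \<and> closure {x. \<phi> x \<noteq> 0} \<subseteq> \<Omega>"

definition is_weak_div ::
    "(real ^ 'd) set \<Rightarrow> (real ^ 'd \<Rightarrow> real ^ 'd) \<Rightarrow> (real ^ 'd \<Rightarrow> real) \<Rightarrow> bool" where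
  "is_weak_div \<Omega> v w \<longleftrightarrow>
     (\<forall>\<phi>. test_function \<Omega> \<phi> \<longrightarrow>
        (LINT x|lebesgue_on \<Omega>. v x \<bullet> grad \<phi> x) = - (LINT x|lebesgue_on \<Omega>. w x * \<phi> x))"

definition X_space :: "(real ^ 'd) set \<Rightarrow> (real ^ 'd \<Rightarrow> real ^ 'd) set" where
  "X_space \<Omega> = {v \<in> L3_space \<Omega>. \<exists>w \<in> L2_space \<Omega>. is_weak_div \<Omega> v w}"

text \<open>A representative of the weak divergence, which is unique up to null sets.\<close>

definition wdiv :: "(real ^ 'd) set \<Rightarrow> (real ^ 'd \<Rightarrow> real ^ 'd) \<Rightarrow> real ^ 'd \<Rightarrow> real" where
  "wdiv \<Omega> v = (SOME w. w \<in> L2_space \<Omega> \<and> is_weak_div \<Omega> v w)"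

definition X_norm :: "(real ^ 'd) set \<Rightarrow> (real ^ 'd \<Rightarrow> real ^ 'd) \<Rightarrow> real" where
  "X_norm \<Omega> v = L3_norm \<Omega> v + L2_norm \<Omega> (wdiv \<Omega> v)"


section \<open>Data\<close>

definition Linfty_matrix :: "(real ^ 'd) set \<Rightarrow> (real ^ 'd \<Rightarrow> real ^ 'd ^ 'd) \<Rightarrow> bool" where
  "Linfty_matrix \<Omega> A \<longleftrightarrow>
     A \<in> borel_measurable (lebesgue_on \<Omega>) \<and>
     (\<exists>C. AE x in lebesgue_on \<Omega>. norm (A x) \<le> C)"

definition uniformly_pos_def :: "(real ^ 'd) set \<Rightarrow> (real ^ 'd \<Rightarrow> real ^ 'd ^ 'd) \<Rightarrow> bool" where
  "uniformly_pos_def \<Omega> A \<longleftrightarrow>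
     (\<exists>c>0. AE x in lebesgue_on \<Omega>. \<forall>\<xi>. (A x *v \<xi>) \<bullet> \<xi> \<ge> c * (norm \<xi>)\<^sup>2)"

definition permeability_tensor :: "(real ^ 'd) set \<Rightarrow> (real ^ 'd \<Rightarrow> real ^ 'd ^ 'd) \<Rightarrow> bool" where
  "permeability_tensor \<Omega> K \<longleftrightarrow>
     (AE x in lebesgue_on \<Omega>. transpose (K x) = K x) \<and>
     Linfty_matrix \<Omega> K \<and> uniformly_pos_def \<Omega> K \<and>
     Linfty_matrix \<Omega> (\<lambda>x. matrix_inv (K x)) \<and> uniformly_pos_def \<Omega> (\<lambda>x. matrix_inv (K x))"

text \<open>Integrability is required explicitly because the integral of a non-integrable function
  is \<open>0\<close> by convention; with it, linearity of the functional is automatic.\<close>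

definition bounded_load :: "(real ^ 'd) set \<Rightarrow> (real ^ 'd \<Rightarrow> real ^ 'd) \<Rightarrow> bool" where
  "bounded_load \<Omega> f \<longleftrightarrow>
     (\<forall>v\<in>X_space \<Omega>. integrable (lebesgue_on \<Omega>) (\<lambda>x. f x \<bullet> v x)) \<and>
     (\<exists>C. \<forall>v\<in>X_space \<Omega>. \<bar>LINT x|lebesgue_on \<Omega>. f x \<bullet> v x\<bar> \<le> C * X_norm \<Omega> v)"


section \<open>Mixed finite element spaces\<close>

definition fn_span :: "('a \<Rightarrow> 'b::real_vector) set \<Rightarrow> ('a \<Rightarrow> 'b) set" where
  "fn_span B = {v. \<exists>c. v = (\<lambda>x. \<Sum>b\<in>B. c b *\<^sub>R b x)}"

definition local_polynomial_space ::
    "('a::real_normed_vector \<Rightarrow> 'b::real_normed_vector) set \<Rightarrow> bool" where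
  "local_polynomial_space S \<longleftrightarrow>
     (\<exists>B. finite B \<and> S = fn_span B) \<and> (\<forall>v\<in>S. polynomial_function v)"

definition fe_velocity_space ::
    "(real ^ 'd) set \<Rightarrow> (real ^ 'd) set set \<Rightarrow> ((real ^ 'd) set \<Rightarrow> (real ^ 'd \<Rightarrow> real ^ 'd) set)
      \<Rightarrow> (real ^ 'd \<Rightarrow> real ^ 'd) set" where
  "fe_velocity_space \<Omega> \<T> XT =
     {v \<in> X_space \<Omega>. \<forall>T\<in>\<T>. \<exists>w\<in>XT T. AE x in lebesgue_on \<Omega>. x \<in> T \<longrightarrow> v x = w x}"

definition fe_pressure_space ::
    "(real ^ 'd) set \<Rightarrow> (real ^ 'd) set set \<Rightarrow> ((real ^ 'd) set \<Rightarrow> (real ^ 'd \<Rightarrow> real) set)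
      \<Rightarrow> (real ^ 'd \<Rightarrow> real) set" where
  "fe_pressure_space \<Omega> \<T> MT =
     {q \<in> L2_space \<Omega>. \<forall>T\<in>\<T>. \<exists>r\<in>MT T. AE x in lebesgue_on \<Omega>. x \<in> T \<longrightarrow> q x = r x}"

text \<open>A Raviart--Thomas-type pair is a conforming pair built from local polynomial spaces
  \<open>X\<^sub>h(T)\<close>, \<open>M\<^sub>h(T)\<close> (such as \<open>Q\<^bsub>k+1,k\<^esub> \<oplus> Q\<^bsub>k,k+1\<^esub>\<close>, \<open>Q\<^bsub>k,k\<^esub>\<close> on rectangles) for which
  \<open>div X\<^sub>h = M\<^sub>h\<close> as spaces of classes of functions modulo null sets.\<close>

definition RT_type_pair ::
    "(real ^ 'd) set \<Rightarrow> (real ^ 'd) set set \<Rightarrow>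
     (real ^ 'd \<Rightarrow> real ^ 'd) set \<Rightarrow> (real ^ 'd \<Rightarrow> real) set \<Rightarrow> bool" where
  "RT_type_pair \<Omega> \<T> Xh Mh \<longleftrightarrow>
     (\<exists>XT MT.
        (\<forall>T\<in>\<T>. local_polynomial_space (XT T) \<and> local_polynomial_space (MT T)) \<and>
        Xh = fe_velocity_space \<Omega> \<T> XT \<and> Mh = fe_pressure_space \<Omega> \<T> MT) \<and>
     (\<forall>v\<in>Xh. wdiv \<Omega> v \<in> Mh) \<and>
     (\<forall>q\<in>Mh. \<exists>v\<in>Xh. AE x in lebesgue_on \<Omega>. wdiv \<Omega> v x = q x)"

definition is_L2_projection ::
    "(real ^ 'd) set \<Rightarrow> (real ^ 'd \<Rightarrow> real) set \<Rightarrow> (real ^ 'd \<Rightarrow> real) \<Rightarrow> (real ^ 'd \<Rightarrow> real) \<Rightarrow> bool"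
  where
  "is_L2_projection \<Omega> Mh g gh \<longleftrightarrow>
     gh \<in> Mh \<and> (\<forall>q\<in>Mh. (LINT x|lebesgue_on \<Omega>. (g x - gh x) * q x) = 0)"


section \<open>Discrete Darcy--Forchheimer problem and augmented Lagrangian method\<close>

definition discrete_DF_solution ::
    "(real ^ 'd) set \<Rightarrow> real \<Rightarrow> real \<Rightarrow> real \<Rightarrow> (real ^ 'd \<Rightarrow> real ^ 'd ^ 'd) \<Rightarrow>
     (real ^ 'd \<Rightarrow> real ^ 'd) \<Rightarrow> (real ^ 'd \<Rightarrow> real) \<Rightarrow>
     (real ^ 'd \<Rightarrow> real ^ 'd) set \<Rightarrow> (real ^ 'd \<Rightarrow> real) set \<Rightarrow>
     (real ^ 'd \<Rightarrow> real ^ 'd) \<Rightarrow> (real ^ 'd \<Rightarrow> real) \<Rightarrow> bool" where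
  "discrete_DF_solution \<Omega> \<mu> \<rho> \<beta> K f g Xh Mh uh ph \<longleftrightarrow>
     uh \<in> Xh \<and> ph \<in> Mh \<and>
     (\<forall>v\<in>Xh.
        \<mu> / \<rho> * (LINT x|lebesgue_on \<Omega>. (matrix_inv (K x) *v uh x) \<bullet> v x)
        + \<beta> / \<rho> * (LINT x|lebesgue_on \<Omega>. (norm (uh x) *\<^sub>R uh x) \<bullet> v x)
        - (LINT x|lebesgue_on \<Omega>. ph x * wdiv \<Omega> v x)
        = (LINT x|lebesgue_on \<Omega>. f x \<bullet> v x)) \<and>
     (\<forall>q\<in>Mh. (LINT x|lebesgue_on \<Omega>. q x * wdiv \<Omega> uh x) = (LINT x|lebesgue_on \<Omega>. g x * q x))"

definition DF_energy ::
    "(real ^ 'd) set \<Rightarrow> real \<Rightarrow> real \<Rightarrow> real \<Rightarrow> (real ^ 'd \<Rightarrow> real ^ 'd ^ 'd) \<Rightarrow>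
     (real ^ 'd \<Rightarrow> real ^ 'd) \<Rightarrow> (real ^ 'd \<Rightarrow> real ^ 'd) \<Rightarrow> real" where
  "DF_energy \<Omega> \<mu> \<rho> \<beta> K f v =
     \<mu> / (2 * \<rho>) * (LINT x|lebesgue_on \<Omega>. (matrix_inv (K x) *v v x) \<bullet> v x)
     + \<beta> / (3 * \<rho>) * (LINT x|lebesgue_on \<Omega>. norm (v x) ^ 3)
     - (LINT x|lebesgue_on \<Omega>. f x \<bullet> v x)"

definition gateaux_deriv ::
    "(('a \<Rightarrow> 'b::real_vector) \<Rightarrow> real) \<Rightarrow> ('a \<Rightarrow> 'b) \<Rightarrow> ('a \<Rightarrow> 'b) \<Rightarrow> real" where
  "gateaux_deriv F v w = deriv (\<lambda>t. F (\<lambda>x. v x + t *\<^sub>R w x)) 0"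

definition bregman_sym ::
    "(('a \<Rightarrow> 'b::real_vector) \<Rightarrow> real) \<Rightarrow> ('a \<Rightarrow> 'b) \<Rightarrow> ('a \<Rightarrow> 'b) \<Rightarrow> real" where
  "bregman_sym F v w =
     gateaux_deriv F v (\<lambda>x. v x - w x) - gateaux_deriv F w (\<lambda>x. v x - w x)"

text \<open>The velocity iterates start at index \<open>1\<close>; \<open>u 0\<close> is unconstrained and never used.\<close>

definition ALM_sequence ::
    "(real ^ 'd) set \<Rightarrow> ((real ^ 'd \<Rightarrow> real ^ 'd) \<Rightarrow> real) \<Rightarrow> (real ^ 'd \<Rightarrow> real ^ 'd) set \<Rightarrow>
     (real ^ 'd \<Rightarrow> real) \<Rightarrow> real \<Rightarrow> (real ^ 'd \<Rightarrow> real) \<Rightarrow>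
     (nat \<Rightarrow> real ^ 'd \<Rightarrow> real ^ 'd) \<Rightarrow> (nat \<Rightarrow> real ^ 'd \<Rightarrow> real) \<Rightarrow> bool" where
  "ALM_sequence \<Omega> F Xh gh \<epsilon> p0 u p \<longleftrightarrow>
     p 0 = p0 \<and>
     (\<forall>n.
        is_arg_min
          (\<lambda>v. F v - (LINT x|lebesgue_on \<Omega>. p n x * wdiv \<Omega> v x)
               + 1 / (2 * \<epsilon>) * (LINT x|lebesgue_on \<Omega>. (wdiv \<Omega> v x - gh x)\<^sup>2))
          (\<lambda>v. v \<in> Xh) (u (Suc n)) \<and>
        (AE x in lebesgue_on \<Omega>.
           p (Suc n) x = p n x - inverse \<epsilon> * (wdiv \<Omega> (u (Suc n)) x - gh x)))"

end

theory Submission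
  imports Defs
begin

text \<open>
  Write \<open>e\<^sub>n = p\<^sub>n - p\<^sub>h\<close> and let \<open>D\<close> be the symmetrised Bregman divergence of \<open>u\<^sub>n\<^sub>+\<^sub>1\<close> and \<open>u\<^sub>h\<close>.
  The optimality condition of the minimisation step is
  \<open>\<langle>F'(u\<^sub>n\<^sub>+\<^sub>1) - F'(u\<^sub>h), v\<rangle> = (e\<^sub>n\<^sub>+\<^sub>1, div v)\<close> for all discrete velocities \<open>v\<close>. Since
  \<open>div (u\<^sub>n\<^sub>+\<^sub>1 - u\<^sub>h) = \<epsilon> (e\<^sub>n - e\<^sub>n\<^sub>+\<^sub>1)\<close>, it gives \<open>D = \<epsilon> (e\<^sub>n\<^sub>+\<^sub>1, e\<^sub>n - e\<^sub>n\<^sub>+\<^sub>1)\<close>, which is at most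
  \<open>\<epsilon>/4 \<parallel>e\<^sub>n\<parallel>\<^sup>2\<close>. If moreover \<open>m \<parallel>e\<^sub>n\<^sub>+\<^sub>1\<parallel>\<^sup>2 \<le> D\<close>, then Cauchy--Schwarz yields the contraction
  \<open>\<parallel>e\<^sub>n\<^sub>+\<^sub>1\<parallel> \<le> \<epsilon>/(m + \<epsilon>) \<parallel>e\<^sub>n\<parallel>\<close>.

  Such an \<open>m\<close>, independent of \<open>\<epsilon>\<close>, exists because \<open>M\<^sub>h = div X\<^sub>h\<close> is finite-dimensional: a Parseval
  identity turns \<open>\<parallel>e\<^sub>n\<^sub>+\<^sub>1\<parallel>\<^sup>2\<close> into a finite sum of squares \<open>(e\<^sub>n\<^sub>+\<^sub>1, div v\<^sub>j)\<^sup>2\<close>, and each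
  \<open>\<langle>F'(u\<^sub>n\<^sub>+\<^sub>1) - F'(u\<^sub>h), v\<^sub>j\<rangle>\<^sup>2\<close> is bounded by a multiple of \<open>D + D\<^sup>2\<close>. This suffices for \<open>D \<le> 1\<close>; for
  \<open>D > 1\<close> one uses that \<open>\<parallel>e\<^sub>n\<^sub>+\<^sub>1\<parallel> \<le> \<parallel>e\<^sub>0\<parallel>\<close>, which is why \<open>m\<close> depends on \<open>p\<^sub>0\<close>.
\<close>

section \<open>Smooth functions and the fundamental lemma\<close>

lemma grad_nth:
  assumes "(\<phi> has_derivative D) (at x)"
  shows "grad \<phi> x $ i = D (axis i 1)"
  using frechet_derivative_at[OF assms] by (simp add: grad_def)

lemma Ck_SucI:
  assumes "\<And>x. (\<phi> has_derivative D x) (at x)" and "\<And>i. Ck k (\<lambda>x. D x (axis i 1))"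
  shows "Ck (Suc k) \<phi>"
  using assms by (auto simp: differentiable_def grad_nth[OF assms(1)])

lemma Ck_SucD:
  assumes "Ck (Suc k) \<phi>"
  shows "\<exists>D. (\<forall>x. (\<phi> has_derivative D x) (at x)) \<and> (\<forall>i. Ck k (\<lambda>x. D x (axis i 1)))"
proof (intro exI conjI allI)
  show D: "(\<phi> has_derivative frechet_derivative \<phi> (at x)) (at x)" for x
    using assms by (simp add: frechet_derivative_works)
  show "Ck k (\<lambda>x. frechet_derivative \<phi> (at x) (axis i 1))" for i
    using assms by (simp add: grad_nth[OF D])
qed

lemma Ck_Suc_imp_Ck: "Ck (Suc k) \<phi> \<Longrightarrow> Ck k \<phi>"
proof (induction k arbitrary: \<phi>)
  case 0
  then show ?case
    by (auto intro!: continuous_at_imp_continuous_on differentiable_imp_continuous_within)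
next
  case (Suc k)
  then show ?case
    using Ck_SucD[OF Suc.prems] by (metis Ck_SucI)
qed

lemma Ck_const: "Ck k (\<lambda>x. c)"
proof (induction k arbitrary: c)
  case (Suc k)
  then show ?case by (intro Ck_SucI[where D = "\<lambda>x h. 0"]) auto
qed simp

lemma Ck_nth: "Ck k (\<lambda>x. x $ i)"
proof (cases k)
  case (Suc k')
  then show ?thesis
    by (simp only:) (rule Ck_SucI[where D = "\<lambda>x h. h $ i"],
      auto intro: bounded_linear_imp_has_derivative bounded_linear_vec_nth Ck_const)
qed (simp add: continuous_intros)

lemma Ck_add: "Ck k \<phi> \<Longrightarrow> Ck k \<psi> \<Longrightarrow> Ck k (\<lambda>x. \<phi> x + \<psi> x)"
proof (induction k arbitrary: \<phi> \<psi>)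
  case (Suc k)
  obtain D where "\<And>x. (\<phi> has_derivative D x) (at x)" "\<And>i. Ck k (\<lambda>x. D x (axis i 1))"
    using Ck_SucD[OF Suc.prems(1)] by blast
  moreover obtain E where "\<And>x. (\<psi> has_derivative E x) (at x)" "\<And>i. Ck k (\<lambda>x. E x (axis i 1))"
    using Ck_SucD[OF Suc.prems(2)] by blast
  ultimately show ?case
    by (intro Ck_SucI[where D = "\<lambda>x h. D x h + E x h"] has_derivative_add Suc.IH)
qed (simp add: continuous_intros)

lemma Ck_mult: "Ck k \<phi> \<Longrightarrow> Ck k \<psi> \<Longrightarrow> Ck k (\<lambda>x. \<phi> x * \<psi> x)"
proof (induction k arbitrary: \<phi> \<psi>)
  case (Suc k)
  note Ck_\<phi>\<psi> = Suc.prems[THEN Ck_Suc_imp_Ck]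
  obtain D where "\<And>x. (\<phi> has_derivative D x) (at x)" "\<And>i. Ck k (\<lambda>x. D x (axis i 1))"
    using Ck_SucD[OF Suc.prems(1)] by blast
  moreover obtain E where "\<And>x. (\<psi> has_derivative E x) (at x)" "\<And>i. Ck k (\<lambda>x. E x (axis i 1))"
    using Ck_SucD[OF Suc.prems(2)] by blast
  ultimately show ?case
    by (intro Ck_SucI[where D = "\<lambda>x h. \<phi> x * E x h + D x h * \<psi> x"] has_derivative_mult
        Ck_add Suc.IH Ck_\<phi>\<psi>)
qed (simp add: continuous_intros)

lemma Ck_sum: "(\<And>j. j \<in> J \<Longrightarrow> Ck k (\<phi> j)) \<Longrightarrow> Ck k (\<lambda>x. \<Sum>j\<in>J. \<phi> j x)"
  by (induction J rule: infinite_finite_induct) (simp_all add: Ck_const Ck_add)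

text \<open>The division by \<open>t ^ m\<close> makes this family closed under differentiation up to linear
  combinations.\<close>

definition flat_exp :: "nat \<Rightarrow> real \<Rightarrow> real" where
  "flat_exp m t = (if t > 0 then exp (- 1 / t) / t ^ m else 0)"

lemma flat_exp_tendsto_0: "(flat_exp m \<longlongrightarrow> 0) (at 0)"
proof (rule filterlim_split_at)
  show "(flat_exp m \<longlongrightarrow> 0) (at_left 0)"
    by (rule tendsto_eventually) (auto simp: flat_exp_def eventually_at_filter)
  have "((\<lambda>z::real. z ^ m / exp z) \<longlongrightarrow> 0) at_top"
    by (rule tendsto_power_div_exp_0)
  then have "((\<lambda>t::real. inverse t ^ m / exp (inverse t)) \<longlongrightarrow> 0) (at_right 0)"
    by (rule filterlim_compose) (rule filterlim_inverse_at_top_right)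
  moreover have "\<forall>\<^sub>F t in at_right 0. flat_exp m t = inverse t ^ m / exp (inverse t)"
    by (auto simp: flat_exp_def exp_minus field_simps eventually_at_filter)
  ultimately show "(flat_exp m \<longlongrightarrow> 0) (at_right 0)"
    by (simp add: filterlim_cong)
qed

lemma flat_exp_has_real_derivative:
  "(flat_exp m has_real_derivative flat_exp (m + 2) t - real m * flat_exp (m + 1) t) (at t)"
proof -
  consider "t > 0" | "t < 0" | "t = 0" by linarith
  then show ?thesis
  proof cases
    assume "t > 0"
    let ?d = "(exp (- 1 / t) * (1 / t\<^sup>2) * t ^ m - exp (- 1 / t) * (real m * t ^ (m - 1)))
      / (t ^ m * t ^ m)"
    have "((\<lambda>t. exp (- 1 / t) / t ^ m) has_real_derivative ?d) (at t)"
      using \<open>t > 0\<close> by (auto intro!: derivative_eq_intros simp: power2_eq_square)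
    moreover have "?d = flat_exp (m + 2) t - real m * flat_exp (m + 1) t"
      using \<open>t > 0\<close> by (cases m) (auto simp: flat_exp_def field_simps power2_eq_square)
    ultimately have "((\<lambda>t. exp (- 1 / t) / t ^ m) has_real_derivative
        flat_exp (m + 2) t - real m * flat_exp (m + 1) t) (at t)" by simp
    then show ?thesis
      by (rule has_field_derivative_transform_within_open[where S = "{0<..}"])
         (use \<open>t > 0\<close> in \<open>auto simp: flat_exp_def\<close>)
  next
    assume "t < 0"
    have "(flat_exp m has_real_derivative 0) (at t)"
      by (rule has_field_derivative_transform_within_open[OF DERIV_const, where S = "{..<0}"])
         (use \<open>t < 0\<close> in \<open>auto simp: flat_exp_def\<close>)
    then show ?thesis using \<open>t < 0\<close> by (simp add: flat_exp_def)
  next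
    assume "t = 0"
    moreover have "(\<lambda>s. (flat_exp m s - flat_exp m 0) / (s - 0)) = flat_exp (m + 1)"
      by (auto simp: flat_exp_def mult.commute)
    ultimately show ?thesis
      using flat_exp_tendsto_0[of "m + 1"] by (simp add: has_field_derivative_iff flat_exp_def)
  qed
qed

lemma Ck_flat_exp: "Ck k \<phi> \<Longrightarrow> Ck k (\<lambda>x. flat_exp m (\<phi> x))"
proof (induction k arbitrary: m \<phi>)
  case 0
  have "continuous_on UNIV (flat_exp m)"
    by (intro continuous_at_imp_continuous_on ballI DERIV_isCont[OF flat_exp_has_real_derivative])
  then show ?case
    using 0 by (auto intro: continuous_on_compose2)
next
  case (Suc k)
  have "Ck k \<phi>" using Suc.prems by (rule Ck_Suc_imp_Ck)
  obtain D where D: "\<And>x. (\<phi> has_derivative D x) (at x)" and Ck_D: "\<And>i. Ck k (\<lambda>x. D x (axis i 1))"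
    using Ck_SucD[OF Suc.prems] by blast
  have "((\<lambda>x. flat_exp m (\<phi> x)) has_derivative
      (\<lambda>h. (flat_exp (m + 2) (\<phi> x) + (- real m) * flat_exp (m + 1) (\<phi> x)) * D x h)) (at x)" for x
    using has_derivative_compose[OF D
        flat_exp_has_real_derivative[unfolded has_field_derivative_def]]
    by simp
  then show ?case
    by (rule Ck_SucI) (intro Ck_mult Ck_add Ck_const Suc.IH Ck_D \<open>Ck k \<phi>\<close>)
qed

lemma flat_exp_0_bounds: "0 \<le> flat_exp 0 t" "flat_exp 0 t \<le> 1"
  by (auto simp: flat_exp_def)

lemma flat_exp_0_tendsto_1: "(flat_exp 0 \<longlongrightarrow> 1) at_top"
proof -
  have "((\<lambda>t::real. exp (- 1 / t)) \<longlongrightarrow> exp 0) at_top"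
    by (intro tendsto_exp real_tendsto_divide_at_top[OF tendsto_const] filterlim_ident)
  moreover have "\<forall>\<^sub>F t in at_top. flat_exp 0 t = exp (- 1 / t)"
    using eventually_gt_at_top[of 0] by eventually_elim (simp add: flat_exp_def)
  ultimately show ?thesis by (simp add: filterlim_cong)
qed

definition ball_bump :: "(real ^ 'd) \<times> real \<Rightarrow> real ^ 'd \<Rightarrow> real" where
  "ball_bump = (\<lambda>(a, r) x. flat_exp 0 (r\<^sup>2 - (\<Sum>i\<in>UNIV. (a $ i - x $ i)\<^sup>2)))"

lemma Ck_ball_bump: "Ck k (ball_bump b)"
proof (cases b)
  case (Pair a r)
  have "Ck k (\<lambda>x. flat_exp 0
      (r\<^sup>2 + (- 1) * (\<Sum>i\<in>UNIV. (a $ i + (- 1) * x $ i) * (a $ i + (- 1) * x $ i))))"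
    by (intro Ck_flat_exp Ck_add Ck_mult Ck_sum Ck_const Ck_nth)
  then show ?thesis by (simp add: Pair ball_bump_def power2_eq_square)
qed

lemma ball_bump_nonneg: "ball_bump b x \<ge> 0"
  by (auto simp: ball_bump_def flat_exp_def split: prod.split)

lemma ball_bump_pos_iff:
  assumes "r > 0"
  shows "ball_bump (a, r) x > 0 \<longleftrightarrow> x \<in> ball a r"
proof -
  have "(\<Sum>i\<in>UNIV. (a $ i - x $ i)\<^sup>2) = (dist a x)\<^sup>2"
    by (simp add: dist_norm norm_vec_def L2_set_def sum_nonneg)
  moreover have "(dist a x)\<^sup>2 < r\<^sup>2 \<longleftrightarrow> dist a x < r"
    using assms power_mono_iff[of r "dist a x" 2] by (auto simp: not_le[symmetric])
  ultimately show ?thesis by (simp add: ball_bump_def flat_exp_def)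
qed

lemma open_eq_countable_Union_ball:
  fixes U :: "'a::{metric_space, second_countable_topology} set"
  assumes "open U" and "U \<noteq> {}"
  obtains c :: "nat \<Rightarrow> 'a" and r where "\<And>n. r n > 0" and "\<And>n. cball (c n) (r n) \<subseteq> U"
    and "U = (\<Union>n. ball (c n) (r n))"
proof -
  define \<B> where "\<B> = {ball a e | a e. e > 0 \<and> cball a e \<subseteq> U}"
  have "\<Union>\<B> = U"
  proof
    show "U \<subseteq> \<Union>\<B>"
    proof
      fix a assume "a \<in> U"
      with \<open>open U\<close> obtain e where "e > 0" "cball a e \<subseteq> U"
        unfolding open_contains_cball by blast
      then have "ball a e \<in> \<B>" "a \<in> ball a e"
        by (auto simp: \<B>_def)
      then show "a \<in> \<Union>\<B>" by blast
    qed
  qed (auto simp: \<B>_def subset_eq)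
  moreover obtain \<C> where \<C>: "\<C> \<subseteq> \<B>" "countable \<C>" "\<Union>\<C> = \<Union>\<B>"
  proof (rule Lindelof_openin[of \<B> UNIV])
    show "openin (top_of_set UNIV) S" if "S \<in> \<B>" for S
      using that by (auto simp: \<B>_def)
  qed
  ultimately have "\<Union>\<C> = U" "\<C> \<noteq> {}"
    using \<open>U \<noteq> {}\<close> by auto
  then have enum: "range (from_nat_into \<C>) = \<C>"
    using \<C>(2) by (intro range_from_nat_into)
  have "\<forall>n. \<exists>a e. from_nat_into \<C> n = ball a e \<and> e > 0 \<and> cball a e \<subseteq> U"
    using from_nat_into[OF \<open>\<C> \<noteq> {}\<close>] \<C>(1) unfolding \<B>_def by blast
  then obtain c r where ball: "\<And>n. from_nat_into \<C> n = ball (c n) (r n)"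
    and "\<And>n. r n > 0" and "\<And>n. cball (c n) (r n) \<subseteq> U"
    by metis
  moreover have "U = (\<Union>n. ball (c n) (r n))"
    using enum \<open>\<Union>\<C> = U\<close> unfolding ball[abs_def, symmetric] by simp
  ultimately show thesis by (intro that)
qed

lemma test_function_flat_exp_sum_ball_bump:
  assumes "finite J" and "\<And>j. j \<in> J \<Longrightarrow> r j > 0" and "\<And>j. j \<in> J \<Longrightarrow> cball (c j) (r j) \<subseteq> \<Omega>"
  shows "test_function \<Omega> (\<lambda>x. flat_exp 0 (t * (\<Sum>j\<in>J. ball_bump (c j, r j) x)))"
      (is "test_function _ ?\<phi>")
proof -
  let ?B = "\<Union>j\<in>J. cball (c j) (r j)"
  have "compact ?B" using \<open>finite J\<close> by (intro compact_UN) auto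
  have supp: "closure {x. ?\<phi> x \<noteq> 0} \<subseteq> ?B"
  proof (rule closure_minimal)
    show "{x. ?\<phi> x \<noteq> 0} \<subseteq> ?B"
    proof
      fix x assume "x \<in> {x. ?\<phi> x \<noteq> 0}"
      then have "(\<Sum>j\<in>J. ball_bump (c j, r j) x) \<noteq> 0" by (auto simp: flat_exp_def)
      then obtain j where "j \<in> J" "ball_bump (c j, r j) x \<noteq> 0" by (meson sum.neutral)
      then have "x \<in> ball (c j) (r j)"
        using assms(2) ball_bump_pos_iff ball_bump_nonneg[of "(c j, r j)" x] by fastforce
      with \<open>j \<in> J\<close> show "x \<in> ?B" using ball_subset_cball by blast
    qed
  qed (use \<open>compact ?B\<close> in \<open>rule compact_imp_closed\<close>)
  show ?thesis
    unfolding test_function_def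
  proof (intro conjI allI)
    show "Ck k ?\<phi>" for k
      by (intro Ck_flat_exp Ck_mult Ck_sum Ck_const Ck_ball_bump)
    show "compact (closure {x. ?\<phi> x \<noteq> 0})"
      using bounded_subset[OF compact_imp_bounded[OF \<open>compact ?B\<close>] supp]
      by (simp add: compact_eq_bounded_closed)
    show "closure {x. ?\<phi> x \<noteq> 0} \<subseteq> \<Omega>"
      using supp assms(3) by (rule order_trans[OF _ UN_least])
  qed
qed

lemma flat_exp_sum_ball_bump_tendsto_indicator:
  assumes r: "\<And>n::nat. r n > 0"
  shows "(\<lambda>n. flat_exp 0 (real n * (\<Sum>j<n. ball_bump (c j, r j) x)))
      \<longlonglongrightarrow> indicator (\<Union>n. ball (c n) (r n)) x"
proof (cases "x \<in> (\<Union>n. ball (c n) (r n))")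
  case True
  then obtain i where "x \<in> ball (c i) (r i)" by blast
  then have pos: "ball_bump (c i, r i) x > 0" by (simp add: ball_bump_pos_iff[OF r])
  have "\<forall>\<^sub>F n in sequentially. real n * ball_bump (c i, r i) x
      \<le> real n * (\<Sum>j<n. ball_bump (c j, r j) x)"
    using eventually_gt_at_top[of i]
  proof eventually_elim
    case (elim n)
    then show ?case
      by (intro mult_left_mono member_le_sum) (auto simp: ball_bump_nonneg)
  qed
  moreover have "filterlim (\<lambda>n. real n * ball_bump (c i, r i) x) at_top sequentially"
    using pos by (intro filterlim_at_top_mult_tendsto_pos[OF tendsto_const]
        filterlim_real_sequentially)
  ultimately have "filterlim (\<lambda>n. real n * (\<Sum>j<n. ball_bump (c j, r j) x)) at_top sequentially"
    by (rule filterlim_at_top_mono[rotated])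
  then show ?thesis
    using True filterlim_compose[OF flat_exp_0_tendsto_1] by simp
next
  case False
  then have "ball_bump (c j, r j) x = 0" for j
    using ball_bump_pos_iff[OF r[of j], of "c j" x] ball_bump_nonneg[of "(c j, r j)" x]
    by (auto simp: order_less_le)
  then show ?thesis using False by (simp add: flat_exp_def)
qed

lemma open_indicator_limit_test_functions:
  assumes "open U" and "U \<subseteq> \<Omega>"
  obtains \<phi> where "\<And>n. test_function \<Omega> (\<phi> n)" and "\<And>n x. \<bar>\<phi> n x\<bar> \<le> 1"
    and "\<And>x. (\<lambda>n. \<phi> n x) \<longlonglongrightarrow> indicator U x"
proof (cases "U = {}")
  case True
  have "test_function \<Omega> (\<lambda>x. 0)" by (simp add: test_function_def Ck_const)
  then show thesis using that[of "\<lambda>n x. 0"] True by simp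
next
  case False
  obtain c r where r: "\<And>n::nat. r n > 0" and sub: "\<And>n. cball (c n) (r n) \<subseteq> U"
    and U: "U = (\<Union>n. ball (c n) (r n))"
    using open_eq_countable_Union_ball[OF \<open>open U\<close> False] by metis
  define \<phi> where "\<phi> n x = flat_exp 0 (real n * (\<Sum>j<n. ball_bump (c j, r j) x))" for n x
  have "test_function \<Omega> (\<phi> n)" for n
    unfolding \<phi>_def[abs_def] using r sub \<open>U \<subseteq> \<Omega>\<close>
    by (intro test_function_flat_exp_sum_ball_bump) auto
  moreover have "\<bar>\<phi> n x\<bar> \<le> 1" for n x
    using flat_exp_0_bounds by (simp add: \<phi>_def)
  moreover have "(\<lambda>n. \<phi> n x) \<longlonglongrightarrow> indicator U x" for x
    unfolding \<phi>_def U using r by (rule flat_exp_sum_ball_bump_tendsto_indicator)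
  ultimately show thesis by (rule that)
qed

lemma gdelta_integral_eq_0_if_open_integrals_eq_0:
  fixes q :: "'a::euclidean_space \<Rightarrow> real"
  assumes \<Omega>: "open \<Omega>" and q: "integrable (lebesgue_on \<Omega>) q"
    and zero: "\<And>U. open U \<Longrightarrow> U \<subseteq> \<Omega> \<Longrightarrow> (LINT x|lebesgue_on \<Omega>. indicator U x * q x) = 0"
    and C: "gdelta C" "C \<inter> \<Omega> \<in> sets (lebesgue_on \<Omega>)"
  shows "(LINT x|lebesgue_on \<Omega>. indicator (C \<inter> \<Omega>) x * q x) = 0"
proof -
  obtain F :: "nat \<Rightarrow> 'a set" where F: "\<And>n. open (F n)" "C = (\<Inter>n. F n)"
    using C(1) unfolding gdelta.simps by blast
  define G where "G n = (\<Inter>i\<le>n. F i) \<inter> \<Omega>" for n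
  have G: "open (G n)" "G n \<subseteq> \<Omega>" for n
    unfolding G_def using F(1) \<Omega> by (auto intro!: open_INT)
  then have G_sets: "G n \<in> sets (lebesgue_on \<Omega>)" for n
    using \<Omega> by (auto simp: sets_restrict_space_iff)
  have "(\<lambda>n. LINT x|lebesgue_on \<Omega>. indicat_real (G n) x * q x)
      \<longlonglongrightarrow> (LINT x|lebesgue_on \<Omega>. indicat_real (C \<inter> \<Omega>) x * q x)"
  proof (rule integral_dominated_convergence)
    show "integrable (lebesgue_on \<Omega>) (\<lambda>x. \<bar>q x\<bar>)" using q by simp
    have "decseq G" "(\<Inter>n. G n) = C \<inter> \<Omega>" by (auto simp: G_def F(2) decseq_def)
    then have "(\<lambda>n. indicat_real (G n) x) \<longlonglongrightarrow> indicator (C \<inter> \<Omega>) x" for x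
      using LIMSEQ_indicator_decseq[of G x, where 'a = real] by simp
    then show "AE x in lebesgue_on \<Omega>. (\<lambda>n. indicat_real (G n) x * q x) \<longlonglongrightarrow> indicator (C \<inter> \<Omega>) x * q x"
      by (intro AE_I2 tendsto_mult tendsto_const)
    show "AE x in lebesgue_on \<Omega>. norm (indicat_real (G n) x * q x) \<le> \<bar>q x\<bar>" for n
      by (simp add: indicator_def)
  qed (intro borel_measurable_times borel_measurable_indicator borel_measurable_integrable[OF q]
      G_sets C(2))+
  moreover have "(LINT x|lebesgue_on \<Omega>. indicat_real (G n) x * q x) = 0" for n
    using G by (rule zero)
  ultimately show ?thesis by (simp add: LIMSEQ_const_iff)
qed

lemma AE_eq_0_if_open_integrals_eq_0:
  fixes q :: "'a::euclidean_space \<Rightarrow> real"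
  assumes \<Omega>: "open \<Omega>" and q: "integrable (lebesgue_on \<Omega>) q"
    and zero: "\<And>U. open U \<Longrightarrow> U \<subseteq> \<Omega> \<Longrightarrow> (LINT x|lebesgue_on \<Omega>. indicator U x * q x) = 0"
  shows "AE x in lebesgue_on \<Omega>. q x = 0"
proof (rule density_unique_real[OF q integrable_zero])
  have sets_iff: "S \<in> sets (lebesgue_on \<Omega>) \<longleftrightarrow> S \<in> sets lebesgue \<and> S \<subseteq> \<Omega>" for S
    using \<Omega> by (auto simp: sets_restrict_space_iff)
  fix A assume A: "A \<in> sets (lebesgue_on \<Omega>)"
  then obtain C N where "gdelta C" and N: "N \<in> null_sets lebesgue" "A \<union> N = C"
    unfolding sets_iff by (metis lebesgue_set_almost_gdelta)
  have C_sets: "C \<inter> \<Omega> \<in> sets (lebesgue_on \<Omega>)"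
    using A N(2) null_setsD2[OF N(1)] \<Omega> by (auto simp: sets_iff)
  have "(LINT x|lebesgue_on \<Omega>. indicator A x * q x)
      = (LINT x|lebesgue_on \<Omega>. indicator (C \<inter> \<Omega>) x * q x)"
  proof (rule integral_cong_AE)
    have "AE x in lebesgue_on \<Omega>. x \<notin> N"
      using AE_not_in[OF N(1)] \<Omega> by (subst AE_restrict_space_iff) auto
    then show "AE x in lebesgue_on \<Omega>. indicat_real A x * q x = indicator (C \<inter> \<Omega>) x * q x"
      using AE_space by eventually_elim (use N(2) in \<open>auto simp: indicator_def\<close>)
  qed (intro borel_measurable_times borel_measurable_indicator borel_measurable_integrable[OF q]
      A C_sets)+
  also have "\<dots> = 0"
    using \<Omega> q zero \<open>gdelta C\<close> C_sets by (rule gdelta_integral_eq_0_if_open_integrals_eq_0)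
  finally show "set_lebesgue_integral (lebesgue_on \<Omega>) A q
      = set_lebesgue_integral (lebesgue_on \<Omega>) A (\<lambda>x. 0)"
    by (simp add: set_lebesgue_integral_def)
qed

lemma fundamental_lemma_calculus_of_variations:
  fixes q :: "real ^ 'd \<Rightarrow> real"
  assumes "open \<Omega>" and q: "integrable (lebesgue_on \<Omega>) q"
    and zero: "\<And>\<phi>. test_function \<Omega> \<phi> \<Longrightarrow> (LINT x|lebesgue_on \<Omega>. q x * \<phi> x) = 0"
  shows "AE x in lebesgue_on \<Omega>. q x = 0"
proof (rule AE_eq_0_if_open_integrals_eq_0[OF \<open>open \<Omega>\<close> q])
  fix U assume "open U" "U \<subseteq> \<Omega>"
  then obtain \<phi> where \<phi>: "\<And>n. test_function \<Omega> (\<phi> n)" "\<And>n x. \<bar>\<phi> n x\<bar> \<le> 1"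
    "\<And>x. (\<lambda>n. \<phi> n x) \<longlonglongrightarrow> indicat_real U x"
    using open_indicator_limit_test_functions by metis
  have cont: "continuous_on UNIV (\<phi> n)" for n
    using \<phi>(1)[of n] by (auto simp: test_function_def dest: spec[of _ 0])
  have "(\<lambda>n. LINT x|lebesgue_on \<Omega>. \<phi> n x * q x) \<longlonglongrightarrow> (LINT x|lebesgue_on \<Omega>. indicator U x * q x)"
  proof (rule integral_dominated_convergence)
    show "integrable (lebesgue_on \<Omega>) (\<lambda>x. \<bar>q x\<bar>)" using q by simp
    show "AE x in lebesgue_on \<Omega>. (\<lambda>n. \<phi> n x * q x) \<longlonglongrightarrow> indicator U x * q x"
      by (intro AE_I2 tendsto_mult tendsto_const \<phi>(3))
    show "AE x in lebesgue_on \<Omega>. norm (\<phi> n x * q x) \<le> \<bar>q x\<bar>" for n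
      using \<phi>(2) by (intro AE_I2) (simp add: abs_mult mult_left_le_one_le)
    show "(\<lambda>x. \<phi> n x * q x) \<in> borel_measurable (lebesgue_on \<Omega>)" for n
      using cont[of n] \<open>open \<Omega>\<close> q
      by (intro borel_measurable_times borel_measurable_integrable
          continuous_imp_measurable_on_sets_lebesgue)
        (auto intro: continuous_on_subset)
    show "(\<lambda>x. indicator U x * q x) \<in> borel_measurable (lebesgue_on \<Omega>)"
      using \<open>open U\<close> \<open>U \<subseteq> \<Omega>\<close> \<open>open \<Omega>\<close> q
      by (intro borel_measurable_times borel_measurable_integrable borel_measurable_indicator)
        (auto simp: sets_restrict_space_iff)
  qed
  moreover have "(LINT x|lebesgue_on \<Omega>. \<phi> n x * q x) = 0" for n
    using zero[OF \<phi>(1)] by (simp add: mult.commute)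
  ultimately show "(LINT x|lebesgue_on \<Omega>. indicator U x * q x) = 0"
    by (simp add: LIMSEQ_const_iff)
qed

section \<open>Linear spaces of functions\<close>

definition fn_subspace :: "('a \<Rightarrow> 'b::real_vector) set \<Rightarrow> bool" where
  "fn_subspace V \<longleftrightarrow> (\<lambda>x. 0) \<in> V \<and> (\<forall>v\<in>V. \<forall>w\<in>V. \<forall>t. (\<lambda>x. v x + t *\<^sub>R w x) \<in> V)"

lemma fn_subspaceI:
  assumes "(\<lambda>x. 0) \<in> V" and "\<And>v w t. v \<in> V \<Longrightarrow> w \<in> V \<Longrightarrow> (\<lambda>x. v x + t *\<^sub>R w x) \<in> V"
  shows "fn_subspace V"
  using assms by (simp add: fn_subspace_def)

lemma fn_subspace_0: "fn_subspace V \<Longrightarrow> (\<lambda>x. 0) \<in> V"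
  by (simp add: fn_subspace_def)

lemma fn_subspace_add_scaleR:
  "fn_subspace V \<Longrightarrow> v \<in> V \<Longrightarrow> w \<in> V \<Longrightarrow> (\<lambda>x. v x + t *\<^sub>R w x) \<in> V"
  by (simp add: fn_subspace_def)

lemma fn_subspace_add_scale:
  "fn_subspace V \<Longrightarrow> p \<in> V \<Longrightarrow> q \<in> V \<Longrightarrow> (\<lambda>x. p x + t * q x :: real) \<in> V"
  using fn_subspace_add_scaleR[of V p q t] by simp

lemma fn_subspace_scaleR: "fn_subspace V \<Longrightarrow> v \<in> V \<Longrightarrow> (\<lambda>x. t *\<^sub>R v x) \<in> V"
  using fn_subspace_add_scaleR[OF _ fn_subspace_0] by fastforce

lemma fn_subspace_diff: "fn_subspace V \<Longrightarrow> v \<in> V \<Longrightarrow> w \<in> V \<Longrightarrow> (\<lambda>x. v x - w x) \<in> V"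
  using fn_subspace_add_scaleR[of V v w "- 1"] by simp

lemma fn_subspace_sum:
  assumes "fn_subspace V" and "\<And>j. j \<in> J \<Longrightarrow> v j \<in> V"
  shows "(\<lambda>x. \<Sum>j\<in>J. c j *\<^sub>R v j x) \<in> V"
  using assms(2)
proof (induction J rule: infinite_finite_induct)
  case (insert j J)
  then have "(\<lambda>x. (\<Sum>i\<in>J. c i *\<^sub>R v i x) + c j *\<^sub>R v j x) \<in> V"
    by (intro fn_subspace_add_scaleR assms(1)) auto
  with insert.hyps show ?case by (simp add: add.commute)
qed (simp_all add: fn_subspace_0[OF assms(1)])

lemma fn_subspace_fn_span: "fn_subspace (fn_span B)"
proof (rule fn_subspaceI)
  show "(\<lambda>x. 0) \<in> fn_span B"
    by (auto simp: fn_span_def intro!: exI[of _ "\<lambda>b. 0"])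
  fix v w t assume "v \<in> fn_span B" "w \<in> fn_span B"
  then obtain c d where "v = (\<lambda>x. \<Sum>b\<in>B. c b *\<^sub>R b x)" "w = (\<lambda>x. \<Sum>b\<in>B. d b *\<^sub>R b x)"
    by (auto simp: fn_span_def)
  then have "(\<lambda>x. v x + t *\<^sub>R w x) = (\<lambda>x. \<Sum>b\<in>B. (c b + t * d b) *\<^sub>R b x)"
    by (simp add: scaleR_sum_right sum.distrib scaleR_add_left)
  then show "(\<lambda>x. v x + t *\<^sub>R w x) \<in> fn_span B" by (auto simp: fn_span_def)
qed

lemma fn_span_base:
  assumes "finite B" and "b \<in> B"
  shows "b \<in> fn_span B"
proof -
  have "b x = (\<Sum>b'\<in>B. (if b' = b then 1 else 0) *\<^sub>R b' x)" for x
    using assms by (simp add: if_distrib[of "\<lambda>c. c *\<^sub>R _"] cong: if_cong)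
  then show ?thesis
    unfolding fn_span_def by (intro CollectI exI ext)
qed

section \<open>Cauchy--Schwarz inequalities\<close>

lemma nonneg_quadratic_discriminant:
  fixes A B H :: real
  assumes nonneg: "\<And>t. 0 \<le> A + 2 * t * H + t\<^sup>2 * B" and "B \<ge> 0"
  shows "H\<^sup>2 \<le> A * B"
proof (cases "B = 0")
  case True
  have "H = 0"
  proof (rule ccontr)
    assume "H \<noteq> 0"
    then have "2 * (- (A + 1) / (2 * H)) * H = - (A + 1)" by simp
    then show False using nonneg[of "- (A + 1) / (2 * H)"] True by simp
  qed
  then show ?thesis using True by simp
next
  case False
  have "A + 2 * (- H / B) * H + (- H / B)\<^sup>2 * B = A - H\<^sup>2 / B"
    using False by (simp add: power2_eq_square)
  then have "H\<^sup>2 / B \<le> A"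
    using nonneg[of "- H / B"] by simp
  then show ?thesis using False \<open>B \<ge> 0\<close> by (simp add: pos_divide_le_eq)
qed

lemma Cauchy_Schwarz_integral:
  fixes a b h :: "'a \<Rightarrow> real"
  assumes int: "integrable M a" "integrable M b" "integrable M h"
    and nonneg: "\<And>x. 0 \<le> a x" "\<And>x. 0 \<le> b x" and h: "\<And>x. (h x)\<^sup>2 \<le> a x * b x"
  shows "(LINT x|M. h x)\<^sup>2 \<le> (LINT x|M. a x) * (LINT x|M. b x)"
proof (rule nonneg_quadratic_discriminant)
  fix t
  have "0 \<le> a x + 2 * t * h x + t\<^sup>2 * b x" for x
  proof -
    have "(- (2 * t * h x))\<^sup>2 \<le> 4 * a x * (t\<^sup>2 * b x)"
      using mult_left_mono[OF h, of "(2 * t)\<^sup>2" x] by (simp add: power_mult_distrib mult_ac)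
    also have "\<dots> \<le> (a x + t\<^sup>2 * b x)\<^sup>2"
      using sum_squares_bound[of "a x" "t\<^sup>2 * b x"] unfolding power2_sum by linarith
    finally have "- (2 * t * h x) \<le> a x + t\<^sup>2 * b x"
      by (rule power2_le_imp_le) (simp add: nonneg)
    then show ?thesis by simp
  qed
  then have "0 \<le> (LINT x|M. a x + 2 * t * h x + t\<^sup>2 * b x)"
    by simp
  also have "\<dots> = (LINT x|M. a x) + 2 * t * (LINT x|M. h x) + t\<^sup>2 * (LINT x|M. b x)"
    using int by simp
  finally show "0 \<le> (LINT x|M. a x) + 2 * t * (LINT x|M. h x) + t\<^sup>2 * (LINT x|M. b x)" .
qed (simp add: nonneg)

section \<open>Square-integrable functions\<close>

definition L2_inner :: "(real ^ 'd) set \<Rightarrow> (real ^ 'd \<Rightarrow> real) \<Rightarrow> (real ^ 'd \<Rightarrow> real) \<Rightarrow> real" where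
  "L2_inner \<Omega> p q = (LINT x|lebesgue_on \<Omega>. p x * q x)"

lemma L2_space_measurable: "q \<in> L2_space \<Omega> \<Longrightarrow> q \<in> borel_measurable (lebesgue_on \<Omega>)"
  by (simp add: L2_space_def)

lemma L2_space_integrable_mult:
  assumes "p \<in> L2_space \<Omega>" and "q \<in> L2_space \<Omega>"
  shows "integrable (lebesgue_on \<Omega>) (\<lambda>x. p x * q x)"
proof (rule Bochner_Integration.integrable_bound)
  show "integrable (lebesgue_on \<Omega>) (\<lambda>x. (p x)\<^sup>2 + (q x)\<^sup>2)"
    using assms by (simp add: L2_space_def)
  show "(\<lambda>x. p x * q x) \<in> borel_measurable (lebesgue_on \<Omega>)"
    using assms by (intro borel_measurable_times L2_space_measurable)
  have "\<bar>p x * q x\<bar> \<le> (p x)\<^sup>2 + (q x)\<^sup>2" for x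
    using sum_squares_bound[of "\<bar>p x\<bar>" "\<bar>q x\<bar>"] mult_nonneg_nonneg[of "\<bar>p x\<bar>" "\<bar>q x\<bar>"]
    unfolding abs_mult power2_abs by linarith
  then show "AE x in lebesgue_on \<Omega>. norm (p x * q x) \<le> norm ((p x)\<^sup>2 + (q x)\<^sup>2)" by simp
qed

lemma fn_subspace_L2_space: "fn_subspace (L2_space \<Omega>)"
proof (rule fn_subspaceI)
  fix p q t assume pq: "p \<in> L2_space \<Omega>" "q \<in> L2_space \<Omega>"
  then have "integrable (lebesgue_on \<Omega>) (\<lambda>x. (p x)\<^sup>2 + 2 * t * (p x * q x) + t\<^sup>2 * (q x)\<^sup>2)"
    by (intro Bochner_Integration.integrable_add integrable_mult_right L2_space_integrable_mult)
       (simp_all add: L2_space_def)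
  then have "integrable (lebesgue_on \<Omega>) (\<lambda>x. (p x + t * q x)\<^sup>2)"
    by (simp add: power2_sum power_mult_distrib algebra_simps)
  with pq show "(\<lambda>x. p x + t *\<^sub>R q x) \<in> L2_space \<Omega>"
    by (auto simp: L2_space_def intro: borel_measurable_add borel_measurable_times)
qed (simp add: L2_space_def)

lemma L2_inner_commute: "L2_inner \<Omega> p q = L2_inner \<Omega> q p"
  by (simp add: L2_inner_def mult.commute)

lemma L2_inner_add_scale_left:
  assumes "p \<in> L2_space \<Omega>" and "q \<in> L2_space \<Omega>" and "r \<in> L2_space \<Omega>"
  shows "L2_inner \<Omega> (\<lambda>x. p x + t * q x) r = L2_inner \<Omega> p r + t * L2_inner \<Omega> q r"
  using assms by (simp add: L2_inner_def distrib_right mult.assoc L2_space_integrable_mult)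

lemma L2_inner_diff_left:
  assumes "p \<in> L2_space \<Omega>" and "q \<in> L2_space \<Omega>" and "r \<in> L2_space \<Omega>"
  shows "L2_inner \<Omega> (\<lambda>x. p x - q x) r = L2_inner \<Omega> p r - L2_inner \<Omega> q r"
  using L2_inner_add_scale_left[OF assms, of "- 1"] by simp

lemma L2_inner_sum_left:
  assumes "\<And>j. j \<in> J \<Longrightarrow> q j \<in> L2_space \<Omega>" and "r \<in> L2_space \<Omega>"
  shows "L2_inner \<Omega> (\<lambda>x. \<Sum>j\<in>J. c j * q j x) r = (\<Sum>j\<in>J. c j * L2_inner \<Omega> (q j) r)"
  unfolding L2_inner_def sum_distrib_right
  using assms by (subst Bochner_Integration.integral_sum)
      (auto simp: mult.assoc L2_space_integrable_mult)

lemma L2_inner_cong_AE: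
  assumes "AE x in lebesgue_on \<Omega>. p x = p' x" and "p \<in> L2_space \<Omega>" and "p' \<in> L2_space \<Omega>"
    and "q \<in> L2_space \<Omega>"
  shows "L2_inner \<Omega> p q = L2_inner \<Omega> p' q"
  unfolding L2_inner_def
proof (rule integral_cong_AE)
  show "AE x in lebesgue_on \<Omega>. p x * q x = p' x * q x"
    using assms(1) by eventually_elim simp
qed (intro borel_measurable_times L2_space_measurable assms(2-4))+

lemma L2_norm_nonneg: "0 \<le> L2_norm \<Omega> q"
  by (simp add: L2_norm_def)

lemma L2_norm_power2: "(L2_norm \<Omega> q)\<^sup>2 = L2_inner \<Omega> q q"
  by (simp add: L2_norm_def L2_inner_def power2_eq_square)

lemma L2_norm_cong_AE:
  assumes "AE x in lebesgue_on \<Omega>. p x = q x" and "p \<in> L2_space \<Omega>" and "q \<in> L2_space \<Omega>"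
  shows "L2_norm \<Omega> p = L2_norm \<Omega> q"
proof -
  have "L2_inner \<Omega> p p = L2_inner \<Omega> q p" and "L2_inner \<Omega> p q = L2_inner \<Omega> q q"
    using assms by (blast intro: L2_inner_cong_AE)+
  then have "(L2_norm \<Omega> p)\<^sup>2 = (L2_norm \<Omega> q)\<^sup>2"
    by (simp add: L2_norm_power2 L2_inner_commute[of \<Omega> q p])
  then show ?thesis
    by (rule power2_eq_imp_eq) (rule L2_norm_nonneg)+
qed

lemma L2_norm_power2_add_scale:
  assumes "p \<in> L2_space \<Omega>" and "q \<in> L2_space \<Omega>"
  shows "(L2_norm \<Omega> (\<lambda>x. p x + t * q x))\<^sup>2
    = (L2_norm \<Omega> p)\<^sup>2 + 2 * t * L2_inner \<Omega> p q + t\<^sup>2 * (L2_norm \<Omega> q)\<^sup>2"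
proof -
  have pq: "(\<lambda>x. p x + t * q x) \<in> L2_space \<Omega>"
    using fn_subspace_L2_space assms by (rule fn_subspace_add_scale)
  show ?thesis
    unfolding L2_norm_power2 L2_inner_add_scale_left[OF assms pq]
    by (subst (1 2) L2_inner_commute)
       (simp add: L2_inner_add_scale_left assms L2_inner_commute[of \<Omega> q p]
         power2_eq_square algebra_simps)
qed

lemma L2_Cauchy_Schwarz:
  assumes "p \<in> L2_space \<Omega>" and "q \<in> L2_space \<Omega>"
  shows "\<bar>L2_inner \<Omega> p q\<bar> \<le> L2_norm \<Omega> p * L2_norm \<Omega> q"
proof -
  have "(L2_inner \<Omega> p q)\<^sup>2 \<le> (LINT x|lebesgue_on \<Omega>. (p x)\<^sup>2) * (LINT x|lebesgue_on \<Omega>. (q x)\<^sup>2)"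
    unfolding L2_inner_def using assms
    by (intro Cauchy_Schwarz_integral L2_space_integrable_mult)
       (simp_all add: L2_space_def power_mult_distrib)
  then have "\<bar>L2_inner \<Omega> p q\<bar>\<^sup>2 \<le> (L2_norm \<Omega> p * L2_norm \<Omega> q)\<^sup>2"
    by (simp add: L2_norm_def power_mult_distrib)
  then show ?thesis
    by (rule power2_le_imp_le) (simp add: L2_norm_nonneg)
qed

lemma L2_norm_eq_0_iff_AE:
  assumes "q \<in> L2_space \<Omega>"
  shows "L2_norm \<Omega> q = 0 \<longleftrightarrow> (AE x in lebesgue_on \<Omega>. q x = 0)"
  using assms by (simp add: L2_norm_def L2_space_def integral_nonneg_eq_0_iff_AE)

lemma L2_orthogonal_projection_residual:
  assumes "finite J" and q: "\<And>j. j \<in> J \<Longrightarrow> q j \<in> L2_space \<Omega>" and b: "b \<in> L2_space \<Omega>"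
    and orth: "pairwise (\<lambda>i j. L2_inner \<Omega> (q i) (q j) = 0) J" and i: "i \<in> J"
  defines "k \<equiv> \<lambda>j. L2_inner \<Omega> b (q j) / L2_inner \<Omega> (q j) (q j)"
  shows "L2_inner \<Omega> (\<lambda>x. b x - (\<Sum>j\<in>J. k j * q j x)) (q i) = 0"
proof -
  have proj: "(\<lambda>x. \<Sum>j\<in>J. k j * q j x) \<in> L2_space \<Omega>"
    using fn_subspace_sum[where v = q and c = k, OF fn_subspace_L2_space q] by simp
  \<comment> \<open>When \<open>(q i, q i) = 0\<close>, division gives \<open>k i = 0\<close>, but then \<open>(b, q i) = 0\<close> by Cauchy--Schwarz.\<close>
  have "L2_inner \<Omega> b (q i) = k i * L2_inner \<Omega> (q i) (q i)"
    using L2_Cauchy_Schwarz[OF b q[OF i]] by (auto simp: k_def simp flip: L2_norm_power2)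
  moreover have "(\<Sum>j\<in>J. k j * L2_inner \<Omega> (q j) (q i)) = k i * L2_inner \<Omega> (q i) (q i)"
    using i orth \<open>finite J\<close>
    by (subst sum.remove[of J i]) (auto simp: pairwise_def intro!: sum.neutral)
  moreover have "L2_inner \<Omega> (\<lambda>x. b x - (\<Sum>j\<in>J. k j * q j x)) (q i)
      = L2_inner \<Omega> b (q i) - (\<Sum>j\<in>J. k j * L2_inner \<Omega> (q j) (q i))"
    using i q b proj by (simp add: L2_inner_diff_left L2_inner_sum_left)
  ultimately show ?thesis by simp
qed

lemma L2_Gram_Schmidt:
  assumes "finite J" and V: "fn_subspace V" "V \<subseteq> L2_space \<Omega>" and "\<And>j. j \<in> J \<Longrightarrow> b j \<in> V"
  shows "\<exists>q. (\<forall>j\<in>J. q j \<in> V) \<and> pairwise (\<lambda>i j. L2_inner \<Omega> (q i) (q j) = 0) J \<and>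
    (\<forall>c. \<exists>d. \<forall>x. (\<Sum>j\<in>J. c j * b j x) = (\<Sum>j\<in>J. d j * q j x))"
  using assms(1,4)
proof (induction J rule: finite_induct)
  case empty
  then show ?case by simp
next
  case (insert s J)
  then obtain q where q: "\<And>j. j \<in> J \<Longrightarrow> q j \<in> V"
    and orth: "pairwise (\<lambda>i j. L2_inner \<Omega> (q i) (q j) = 0) J"
    and span: "\<And>c. \<exists>d. \<forall>x. (\<Sum>j\<in>J. c j * b j x) = (\<Sum>j\<in>J. d j * q j x)"
    by auto
  define k where "k j = L2_inner \<Omega> (b s) (q j) / L2_inner \<Omega> (q j) (q j)" for j
  define r where "r x = b s x - (\<Sum>j\<in>J. k j * q j x)" for x
  have "(\<lambda>x. \<Sum>j\<in>J. k j * q j x) \<in> V"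
    using fn_subspace_sum[where v = q and c = k, OF V(1) q] by simp
  then have r: "r \<in> V"
    unfolding r_def[abs_def] using insert.prems by (intro fn_subspace_diff[OF V(1)]) auto
  have r_orth: "L2_inner \<Omega> r (q i) = 0" "L2_inner \<Omega> (q i) r = 0" if "i \<in> J" for i
    using L2_orthogonal_projection_residual[OF insert.hyps(1) _ _ orth that, of "b s"] q
        insert.prems V(2)
    by (auto simp: r_def[abs_def] k_def L2_inner_commute[of \<Omega> "q i"])
  show ?case
  proof (intro exI[of _ "q(s := r)"] conjI allI)
    show "\<forall>j\<in>insert s J. (q(s := r)) j \<in> V" using q r by simp
    show "pairwise (\<lambda>i j. L2_inner \<Omega> ((q(s := r)) i) ((q(s := r)) j) = 0) (insert s J)"
      using orth r_orth by (auto simp: pairwise_def)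
    fix c
    obtain d where "\<And>x. (\<Sum>j\<in>J. c j * b j x) = (\<Sum>j\<in>J. d j * q j x)"
      using span by blast
    then have "(\<Sum>j\<in>insert s J. c j * b j x) = c s * r x + (\<Sum>j\<in>J. (d j + c s * k j) * q j x)" for x
      using insert.hyps
      by (simp add: r_def distrib_right sum.distrib right_diff_distrib sum_distrib_left mult.assoc)
    also have "c s * r x + (\<Sum>j\<in>J. (d j + c s * k j) * q j x)
        = (\<Sum>j\<in>insert s J. ((\<lambda>j. d j + c s * k j)(s := c s)) j * (q(s := r)) j x)" for x
      using insert.hyps by (auto intro!: sum.cong)
    finally show "\<exists>d. \<forall>x. (\<Sum>j\<in>insert s J. c j * b j x) = (\<Sum>j\<in>insert s J. d j * (q(s := r)) j x)"
      by blast
  qed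
qed

lemma L2_Parseval_family:
  assumes "finite J" and V: "fn_subspace V" "V \<subseteq> L2_space \<Omega>" and "\<And>j. j \<in> J \<Longrightarrow> b j \<in> V"
    and span: "\<And>e. e \<in> V \<Longrightarrow> \<exists>c. AE x in lebesgue_on \<Omega>. e x = (\<Sum>j\<in>J. c j * b j x)"
  shows "\<exists>n. (\<forall>j\<in>J. n j \<in> V) \<and> (\<forall>e\<in>V. (L2_norm \<Omega> e)\<^sup>2 = (\<Sum>j\<in>J. (L2_inner \<Omega> e (n j))\<^sup>2))"
proof -
  obtain q where q: "\<And>j. j \<in> J \<Longrightarrow> q j \<in> V"
    and orth: "pairwise (\<lambda>i j. L2_inner \<Omega> (q i) (q j) = 0) J"
    and combination: "\<And>c. \<exists>d. \<forall>x. (\<Sum>j\<in>J. c j * b j x) = (\<Sum>j\<in>J. d j * q j x)"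
    using L2_Gram_Schmidt[where b = b, OF assms(1-4)] by blast
  have qL2: "\<And>j. j \<in> J \<Longrightarrow> q j \<in> L2_space \<Omega>" using q V(2) by auto
  define n where "n j x = inverse (L2_norm \<Omega> (q j)) * q j x" for j x
  have "(L2_norm \<Omega> e)\<^sup>2 = (\<Sum>j\<in>J. (L2_inner \<Omega> e (n j))\<^sup>2)" if e: "e \<in> V" for e
  proof -
    obtain d where d: "AE x in lebesgue_on \<Omega>. e x = (\<Sum>j\<in>J. d j * q j x)"
      using span[OF e] combination by fastforce
    have eL2: "e \<in> L2_space \<Omega>" "(\<lambda>x. \<Sum>j\<in>J. d j * q j x) \<in> L2_space \<Omega>"
      using e V(2) fn_subspace_sum[where v = q and c = d, OF fn_subspace_L2_space qL2] by auto
    have e_inner: "L2_inner \<Omega> e p = (\<Sum>j\<in>J. d j * L2_inner \<Omega> (q j) p)" if "p \<in> L2_space \<Omega>" for p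
      using L2_inner_cong_AE[OF d eL2 that] qL2 that by (simp add: L2_inner_sum_left)
    have coeff: "L2_inner \<Omega> e (q i) = d i * (L2_norm \<Omega> (q i))\<^sup>2" if i: "i \<in> J" for i
      using i orth \<open>finite J\<close> qL2
      by (subst e_inner)
         (auto simp: sum.remove[of J i] pairwise_def L2_norm_power2 intro!: sum.neutral)
    have "(L2_inner \<Omega> e (n i))\<^sup>2 = d i * L2_inner \<Omega> (q i) e" if i: "i \<in> J" for i
    proof -
      have "L2_inner \<Omega> e (n i) = inverse (L2_norm \<Omega> (q i)) * L2_inner \<Omega> e (q i)"
        by (simp add: L2_inner_def n_def mult.left_commute[of "e _" "inverse (L2_norm \<Omega> (q i))"])
      then show ?thesis
        using coeff[OF i] by (simp add: L2_inner_commute[of \<Omega> "q i"] power2_eq_square field_simps)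
    qed
    then show ?thesis
      using e_inner[OF eL2(1)] by (simp add: L2_norm_power2)
  qed
  moreover have "n j \<in> V" if "j \<in> J" for j
    using fn_subspace_scaleR[OF V(1) q[OF that]] by (simp add: n_def[abs_def])
  ultimately show ?thesis by blast
qed

section \<open>Vector inequalities\<close>

lemma mult3_le_sum_power3:
  fixes a b c :: real
  assumes "0 \<le> a" and "0 \<le> b" and "0 \<le> c"
  shows "a * b * c \<le> a ^ 3 + b ^ 3 + c ^ 3"
proof -
  define m where "m = max a (max b c)"
  have "a * b * c \<le> m * m * m"
    using assms by (intro mult_mono) (auto simp: m_def)
  also have "\<dots> = m ^ 3" by (simp add: power3_eq_cube)
  also have "\<dots> \<le> a ^ 3 + b ^ 3 + c ^ 3"
    using assms[THEN zero_le_power, of 3]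
    unfolding m_def max_def by (auto simp del: zero_le_power)
  finally show ?thesis .
qed

lemma norm_scaleR_diff_le:
  fixes a b :: "'a::real_normed_vector"
  shows "norm (norm a *\<^sub>R a - norm b *\<^sub>R b) \<le> (norm a + norm b) * norm (a - b)"
proof -
  have "norm a *\<^sub>R a - norm b *\<^sub>R b = norm a *\<^sub>R (a - b) + (norm a - norm b) *\<^sub>R b"
    by (simp add: algebra_simps)
  then have "norm (norm a *\<^sub>R a - norm b *\<^sub>R b)
      \<le> norm a * norm (a - b) + \<bar>norm a - norm b\<bar> * norm b"
    by (metis norm_triangle_ineq norm_scaleR abs_norm_cancel real_norm_def)
  also have "\<dots> \<le> norm a * norm (a - b) + norm (a - b) * norm b"
    by (intro add_left_mono mult_right_mono norm_triangle_ineq3) auto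
  finally show ?thesis by (simp add: algebra_simps)
qed

lemma norm_scaleR_strongly_monotone:
  fixes a b :: "'a::real_inner"
  shows "(norm a + norm b) * (norm (a - b))\<^sup>2 \<le> 2 * ((norm a *\<^sub>R a - norm b *\<^sub>R b) \<bullet> (a - b))"
proof -
  have dist_eq: "(norm (a - b))\<^sup>2 = (norm a)\<^sup>2 + (norm b)\<^sup>2 - 2 * (a \<bullet> b)"
    by (simp add: power2_norm_eq_inner inner_diff inner_commute)
  have "(norm a *\<^sub>R a - norm b *\<^sub>R b) \<bullet> (a - b)
      = norm a * (norm a)\<^sup>2 + norm b * (norm b)\<^sup>2 - (norm a + norm b) * (a \<bullet> b)"
    by (simp add: power2_norm_eq_inner inner_diff inner_commute algebra_simps)
  then have "2 * ((norm a *\<^sub>R a - norm b *\<^sub>R b) \<bullet> (a - b)) - (norm a + norm b) * (norm (a - b))\<^sup>2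
      = (norm a + norm b) * (norm a - norm b)\<^sup>2"
    unfolding dist_eq by (simp add: power2_eq_square algebra_simps)
  moreover have "0 \<le> (norm a + norm b) * (norm a - norm b)\<^sup>2" by simp
  ultimately show ?thesis by linarith
qed

lemma norm_power3_subgradient:
  fixes a b :: "'a::real_inner"
  shows "norm a ^ 3 + 3 * ((norm a *\<^sub>R a) \<bullet> (b - a)) \<le> norm b ^ 3"
proof -
  have "norm a ^ 3 + 3 * ((norm a *\<^sub>R a) \<bullet> (b - a)) = 3 * (norm a * (a \<bullet> b)) - 2 * norm a ^ 3"
    by (simp add: inner_diff_right power3_eq_cube dot_square_norm power2_eq_square algebra_simps)
  also have "\<dots> \<le> 3 * (norm a * (norm a * norm b)) - 2 * norm a ^ 3"
    by (intro diff_right_mono mult_left_mono norm_cauchy_schwarz) auto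
  also have "\<dots> = norm b ^ 3 - (norm b - norm a)\<^sup>2 * (norm b + 2 * norm a)"
    by (simp add: power2_eq_square power3_eq_cube algebra_simps)
  also have "\<dots> \<le> norm b ^ 3" by simp
  finally show ?thesis .
qed

lemma norm_power3_expansion:
  fixes a b :: "'a::real_inner"
  assumes "\<bar>t\<bar> \<le> 1"
  shows "\<bar>norm (a + t *\<^sub>R b) ^ 3 - norm a ^ 3 - 3 * t * ((norm a *\<^sub>R a) \<bullet> b)\<bar>
    \<le> 3 * t\<^sup>2 * ((2 * norm a + norm b) * norm b * norm b)"
proof -
  define c where "c = a + t *\<^sub>R b"
  have "norm c \<le> norm a + \<bar>t\<bar> * norm b"
    unfolding c_def using norm_triangle_ineq[of a "t *\<^sub>R b"] by simp
  also have "\<dots> \<le> norm a + norm b"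
    using mult_right_mono[OF assms norm_ge_zero, of b] by simp
  finally have sum_le: "norm c + norm a \<le> 2 * norm a + norm b" by simp
  have "0 \<le> norm c ^ 3 - norm a ^ 3 - 3 * t * ((norm a *\<^sub>R a) \<bullet> b)"
    using norm_power3_subgradient[of a c] by (simp add: c_def)
  moreover have "norm c ^ 3 - norm a ^ 3 - 3 * t * ((norm a *\<^sub>R a) \<bullet> b)
      \<le> 3 * (t * ((norm c *\<^sub>R c - norm a *\<^sub>R a) \<bullet> b))"
    using norm_power3_subgradient[of c a] by (simp add: c_def inner_diff_left algebra_simps)
  moreover have "t * ((norm c *\<^sub>R c - norm a *\<^sub>R a) \<bullet> b)
      \<le> t\<^sup>2 * ((2 * norm a + norm b) * norm b * norm b)"
  proof -
    have "t * ((norm c *\<^sub>R c - norm a *\<^sub>R a) \<bullet> b)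
        \<le> \<bar>t\<bar> * (norm (norm c *\<^sub>R c - norm a *\<^sub>R a) * norm b)"
      by (rule order_trans[OF abs_ge_self])
         (simp add: abs_mult mult_left_mono Cauchy_Schwarz_ineq2 del: inner_diff_left)
    also have "\<dots> \<le> \<bar>t\<bar> * ((norm c + norm a) * norm (c - a) * norm b)"
      by (intro mult_left_mono mult_right_mono norm_scaleR_diff_le) auto
    also have "\<dots> = t\<^sup>2 * ((norm c + norm a) * norm b * norm b)"
      by (simp add: c_def power2_eq_square mult_ac)
    also have "\<dots> \<le> t\<^sup>2 * ((2 * norm a + norm b) * norm b * norm b)"
      using sum_le by (intro mult_left_mono mult_right_mono) auto
    finally show ?thesis .
  qed
  ultimately show ?thesis by (simp add: c_def)
qed

lemma has_real_derivative_quadratic_remainder: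
  fixes h :: "real \<Rightarrow> real"
  assumes "\<And>t. \<bar>t\<bar> \<le> 1 \<Longrightarrow> \<bar>h t - h 0 - t * L\<bar> \<le> C * t\<^sup>2"
  shows "(h has_real_derivative L) (at 0)"
proof -
  have "((\<lambda>t. (h t - h 0) / t - L) \<longlongrightarrow> 0) (at 0)"
  proof (rule Lim_null_comparison)
    show "((\<lambda>t. C * \<bar>t\<bar>) \<longlongrightarrow> 0) (at 0)"
      by (auto intro!: tendsto_eq_intros)
    have "\<forall>\<^sub>F t in at 0. \<bar>t\<bar> \<le> (1::real) \<and> t \<noteq> 0"
      by (auto simp: eventually_at dist_norm intro!: exI[of _ 1])
    then show "\<forall>\<^sub>F t in at 0. norm ((h t - h 0) / t - L) \<le> C * \<bar>t\<bar>"
    proof eventually_elim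
      case (elim t)
      have "\<bar>(h t - h 0) / t - L\<bar> = \<bar>h t - h 0 - t * L\<bar> / \<bar>t\<bar>"
        using elim by (simp add: diff_divide_distrib flip: abs_divide)
      also have "\<dots> \<le> C * t\<^sup>2 / \<bar>t\<bar>"
        using assms[of t] elim by (intro divide_right_mono) auto
      also have "\<dots> = C * \<bar>t\<bar>"
        using elim by (simp add: field_simps power2_eq_square abs_mult_self_eq)
      finally show ?case by simp
    qed
  qed
  then show ?thesis
    by (simp add: has_field_derivative_iff Lim_null[of _ L])
qed

section \<open>The Forchheimer nonlinearity on \<open>L\<^sup>3\<close>\<close>

lemma L3_space_measurable: "v \<in> L3_space \<Omega> \<Longrightarrow> v \<in> borel_measurable (lebesgue_on \<Omega>)"
  by (simp add: L3_space_def)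

lemma L3_space_integrable_power3: "v \<in> L3_space \<Omega> \<Longrightarrow> integrable (lebesgue_on \<Omega>) (\<lambda>x. norm (v x) ^ 3)"
  by (simp add: L3_space_def)

lemma L3_space_integrable_mult3:
  assumes "u \<in> L3_space \<Omega>" and "v \<in> L3_space \<Omega>" and "w \<in> L3_space \<Omega>"
  shows "integrable (lebesgue_on \<Omega>) (\<lambda>x. norm (u x) * norm (v x) * norm (w x))"
proof (rule Bochner_Integration.integrable_bound)
  show "integrable (lebesgue_on \<Omega>) (\<lambda>x. norm (u x) ^ 3 + norm (v x) ^ 3 + norm (w x) ^ 3)"
    using assms by (intro Bochner_Integration.integrable_add L3_space_integrable_power3)
  show "(\<lambda>x. norm (u x) * norm (v x) * norm (w x)) \<in> borel_measurable (lebesgue_on \<Omega>)"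
    using assms[THEN L3_space_measurable] by measurable
  show "AE x in lebesgue_on \<Omega>. norm (norm (u x) * norm (v x) * norm (w x))
      \<le> norm (norm (u x) ^ 3 + norm (v x) ^ 3 + norm (w x) ^ 3)"
    by (intro AE_I2) (simp add: mult3_le_sum_power3)
qed

lemma fn_subspace_L3_space: "fn_subspace (L3_space \<Omega>)"
proof (rule fn_subspaceI)
  fix v w t
  assume vw: "v \<in> L3_space \<Omega>" "w \<in> L3_space \<Omega>"
  let ?bound = "\<lambda>x. 4 * norm (v x) ^ 3 + 4 * \<bar>t\<bar> ^ 3 * norm (w x) ^ 3"
  have meas: "(\<lambda>x. v x + t *\<^sub>R w x) \<in> borel_measurable (lebesgue_on \<Omega>)"
    using vw by (intro borel_measurable_add borel_measurable_scaleR L3_space_measurable) auto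
  have "integrable (lebesgue_on \<Omega>) (\<lambda>x. norm (v x + t *\<^sub>R w x) ^ 3)"
  proof (rule Bochner_Integration.integrable_bound)
    show "integrable (lebesgue_on \<Omega>) ?bound"
      using vw by (intro Bochner_Integration.integrable_add integrable_mult_right
          L3_space_integrable_power3)
    have "norm (v x + t *\<^sub>R w x) ^ 3 \<le> ?bound x" for x
    proof -
      define a where "a = norm (v x)"
      define b where "b = \<bar>t\<bar> * norm (w x)"
      have "norm (v x + t *\<^sub>R w x) \<le> a + b"
        unfolding a_def b_def using norm_triangle_ineq[of "v x" "t *\<^sub>R w x"] by simp
      then have "norm (v x + t *\<^sub>R w x) ^ 3 \<le> (a + b) ^ 3" by (rule power_mono) simp
      also have "\<dots> = 4 * a ^ 3 + 4 * b ^ 3 - 3 * ((a + b) * (a - b)\<^sup>2)"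
        by (simp add: power2_eq_square power3_eq_cube algebra_simps)
      also have "\<dots> \<le> 4 * a ^ 3 + 4 * b ^ 3" by (simp add: a_def b_def)
      finally show ?thesis by (simp add: a_def b_def power_mult_distrib)
    qed
    then show "AE x in lebesgue_on \<Omega>. norm (norm (v x + t *\<^sub>R w x) ^ 3) \<le> norm (?bound x)"
      by (intro AE_I2) simp
  qed (use meas in simp)
  with meas show "(\<lambda>x. v x + t *\<^sub>R w x) \<in> L3_space \<Omega>" by (simp add: L3_space_def)
qed (simp add: L3_space_def)

definition Forchheimer_form ::
    "(real ^ 'd) set \<Rightarrow> (real ^ 'd \<Rightarrow> real ^ 'd) \<Rightarrow> (real ^ 'd \<Rightarrow> real ^ 'd) \<Rightarrow> real" where
  "Forchheimer_form \<Omega> v w = (LINT x|lebesgue_on \<Omega>. (norm (v x) *\<^sub>R v x) \<bullet> w x)"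

lemma Forchheimer_form_integrable:
  assumes "v \<in> L3_space \<Omega>" and "w \<in> L3_space \<Omega>"
  shows "integrable (lebesgue_on \<Omega>) (\<lambda>x. (norm (v x) *\<^sub>R v x) \<bullet> w x)"
proof (rule Bochner_Integration.integrable_bound[OF L3_space_integrable_mult3[OF assms(1) assms]])
  show "(\<lambda>x. (norm (v x) *\<^sub>R v x) \<bullet> w x) \<in> borel_measurable (lebesgue_on \<Omega>)"
    using assms[THEN L3_space_measurable] by measurable
  show "AE x in lebesgue_on \<Omega>. norm ((norm (v x) *\<^sub>R v x) \<bullet> w x)
      \<le> norm (norm (v x) * norm (v x) * norm (w x))"
    by (intro AE_I2) (simp add: abs_mult mult.assoc mult_left_mono Cauchy_Schwarz_ineq2)
qed

lemma Forchheimer_form_diff_left: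
  assumes "u \<in> L3_space \<Omega>" and "v \<in> L3_space \<Omega>" and "w \<in> L3_space \<Omega>"
  shows "integrable (lebesgue_on \<Omega>) (\<lambda>x. (norm (u x) *\<^sub>R u x - norm (v x) *\<^sub>R v x) \<bullet> w x)"
    and "Forchheimer_form \<Omega> u w - Forchheimer_form \<Omega> v w
      = (LINT x|lebesgue_on \<Omega>. (norm (u x) *\<^sub>R u x - norm (v x) *\<^sub>R v x) \<bullet> w x)"
  unfolding Forchheimer_form_def inner_diff_left
  using assms by (simp_all add: Forchheimer_form_integrable del: inner_scaleR_left)

lemma integral_norm_power3_has_derivative:
  assumes v: "v \<in> L3_space \<Omega>" and w: "w \<in> L3_space \<Omega>"
  shows "((\<lambda>t. LINT x|lebesgue_on \<Omega>. norm (v x + t *\<^sub>R w x) ^ 3) has_real_derivative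
    3 * Forchheimer_form \<Omega> v w) (at 0)"
proof (rule has_real_derivative_quadratic_remainder)
  define R where "R x = 3 * ((2 * norm (v x) + norm (w x)) * norm (w x) * norm (w x))" for x
  fix t :: real assume "\<bar>t\<bar> \<le> 1"
  have vw: "(\<lambda>x. v x + t *\<^sub>R w x) \<in> L3_space \<Omega>"
    using fn_subspace_L3_space v w by (rule fn_subspace_add_scaleR)
  have "integrable (lebesgue_on \<Omega>)
      (\<lambda>x. 6 * (norm (v x) * norm (w x) * norm (w x)) + 3 * (norm (w x) * norm (w x) * norm (w x)))"
    using v w by (intro Bochner_Integration.integrable_add integrable_mult_right
        L3_space_integrable_mult3)
  then have R: "integrable (lebesgue_on \<Omega>) (\<lambda>x. t\<^sup>2 * R x)"
    by (intro integrable_mult_right) (simp add: R_def algebra_simps)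
  have int: "integrable (lebesgue_on \<Omega>)
      (\<lambda>x. norm (v x + t *\<^sub>R w x) ^ 3 - norm (v x) ^ 3 - 3 * t * ((norm (v x) *\<^sub>R v x) \<bullet> w x))"
    using v w vw by (intro Bochner_Integration.integrable_diff integrable_mult_right
        L3_space_integrable_power3 Forchheimer_form_integrable)
  have "\<bar>LINT x|lebesgue_on \<Omega>.
        norm (v x + t *\<^sub>R w x) ^ 3 - norm (v x) ^ 3 - 3 * t * ((norm (v x) *\<^sub>R v x) \<bullet> w x)\<bar>
      \<le> (LINT x|lebesgue_on \<Omega>. t\<^sup>2 * R x)"
  proof (rule integral_abs_bound_integral[OF int R])
    show "\<bar>norm (v x + t *\<^sub>R w x) ^ 3 - norm (v x) ^ 3 - 3 * t * ((norm (v x) *\<^sub>R v x) \<bullet> w x)\<bar>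
        \<le> t\<^sup>2 * R x" for x
      using norm_power3_expansion[OF \<open>\<bar>t\<bar> \<le> 1\<close>, of "v x" "w x"] by (simp add: R_def mult_ac)
  qed
  then show "\<bar>(LINT x|lebesgue_on \<Omega>. norm (v x + t *\<^sub>R w x) ^ 3)
      - (LINT x|lebesgue_on \<Omega>. norm (v x + 0 *\<^sub>R w x) ^ 3)
      - t * (3 * Forchheimer_form \<Omega> v w)\<bar> \<le> (LINT x|lebesgue_on \<Omega>. R x) * t\<^sup>2"
    using v w vw L3_space_integrable_power3[OF v] L3_space_integrable_power3[OF vw]
    by (simp add: Forchheimer_form_def Forchheimer_form_integrable mult_ac del: inner_scaleR_left)
qed

definition Forchheimer_gap ::
    "(real ^ 'd) set \<Rightarrow> (real ^ 'd \<Rightarrow> real ^ 'd) \<Rightarrow> (real ^ 'd \<Rightarrow> real ^ 'd) \<Rightarrow> real" where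
  "Forchheimer_gap \<Omega> u v =
     Forchheimer_form \<Omega> u (\<lambda>x. u x - v x) - Forchheimer_form \<Omega> v (\<lambda>x. u x - v x)"

context
  fixes \<Omega> :: "(real ^ 'd) set" and u v :: "real ^ 'd \<Rightarrow> real ^ 'd"
  assumes u: "u \<in> L3_space \<Omega>" and v: "v \<in> L3_space \<Omega>"
begin

private abbreviation "gap x \<equiv> (norm (u x) *\<^sub>R u x - norm (v x) *\<^sub>R v x) \<bullet> (u x - v x)"

lemma Forchheimer_gap_integral:
  shows "integrable (lebesgue_on \<Omega>) gap" and "Forchheimer_gap \<Omega> u v = (LINT x|lebesgue_on \<Omega>. gap x)"
  unfolding Forchheimer_gap_def
  using Forchheimer_form_diff_left[OF u v fn_subspace_diff[OF fn_subspace_L3_space u v]] .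

lemma Forchheimer_gap_integrand_nonneg: "0 \<le> gap x"
proof -
  have "0 \<le> (norm (u x) + norm (v x)) * (norm (u x - v x))\<^sup>2" by simp
  also have "\<dots> \<le> 2 * gap x" by (rule norm_scaleR_strongly_monotone)
  finally show ?thesis by simp
qed

lemma Forchheimer_gap_nonneg: "0 \<le> Forchheimer_gap \<Omega> u v"
  unfolding Forchheimer_gap_integral
  by (intro Bochner_Integration.integral_nonneg Forchheimer_gap_integrand_nonneg)

lemma Forchheimer_weight_integrable:
  assumes "w \<in> L3_space \<Omega>"
  shows "integrable (lebesgue_on \<Omega>) (\<lambda>x. (norm (u x) + norm (v x)) * norm (w x) * norm (w x))"
  unfolding distrib_right
  using u v assms by (intro Bochner_Integration.integrable_add L3_space_integrable_mult3)

text \<open>The idea is Cauchy--Schwarz with the weight \<open>|u| + |v|\<close>: by monotonicity the gap controls the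
  weighted square of \<open>u - v\<close>. It also controls the integral of \<open>|u - v|\<^sup>3\<close>, and hence the remaining
  weight, which still contains \<open>u\<close>.\<close>

lemma Forchheimer_form_diff_power2_le:
  assumes w: "w \<in> L3_space \<Omega>"
  shows "(Forchheimer_form \<Omega> u w - Forchheimer_form \<Omega> v w)\<^sup>2
    \<le> 2 * Forchheimer_gap \<Omega> u v
      * (LINT x|lebesgue_on \<Omega>. (norm (u x) + norm (v x)) * norm (w x) * norm (w x))"
proof -
  let ?h = "\<lambda>x. (norm (u x) *\<^sub>R u x - norm (v x) *\<^sub>R v x) \<bullet> w x"
  let ?b = "\<lambda>x. (norm (u x) + norm (v x)) * norm (w x) * norm (w x)"
  have "(?h x)\<^sup>2 \<le> 2 * gap x * ?b x" for x
  proof -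
    have "\<bar>?h x\<bar> \<le> norm (norm (u x) *\<^sub>R u x - norm (v x) *\<^sub>R v x) * norm (w x)"
      by (rule Cauchy_Schwarz_ineq2)
    also have "\<dots> \<le> (norm (u x) + norm (v x)) * norm (u x - v x) * norm (w x)"
      by (intro mult_right_mono norm_scaleR_diff_le) simp
    finally have "\<bar>?h x\<bar>\<^sup>2 \<le> ((norm (u x) + norm (v x)) * norm (u x - v x) * norm (w x))\<^sup>2"
      by (rule power_mono) simp
    then have "(?h x)\<^sup>2 \<le> (norm (u x) + norm (v x)) * (norm (u x - v x))\<^sup>2 * ?b x"
      by (simp add: power2_eq_square mult_ac)
    also have "\<dots> \<le> 2 * gap x * ?b x"
      by (intro mult_right_mono norm_scaleR_strongly_monotone) simp
    finally show ?thesis .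
  qed
  then have "(LINT x|lebesgue_on \<Omega>. ?h x)\<^sup>2
      \<le> (LINT x|lebesgue_on \<Omega>. 2 * gap x) * (LINT x|lebesgue_on \<Omega>. ?b x)"
    using Forchheimer_gap_integrand_nonneg
    by (intro Cauchy_Schwarz_integral integrable_mult_right Forchheimer_gap_integral
        Forchheimer_form_diff_left Forchheimer_weight_integrable u v w) auto
  then show ?thesis
    unfolding Forchheimer_form_diff_left(2)[OF u v w] by (simp add: Forchheimer_gap_integral(2))
qed

lemma Forchheimer_weight_integral_le:
  assumes w: "w \<in> L3_space \<Omega>"
  shows "(LINT x|lebesgue_on \<Omega>. (norm (u x) + norm (v x)) * norm (w x) * norm (w x))
    \<le> 2 * Forchheimer_gap \<Omega> u v + 6 * (LINT x|lebesgue_on \<Omega>. norm (w x) ^ 3)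
      + 2 * (LINT x|lebesgue_on \<Omega>. norm (v x) ^ 3)" (is "?lhs \<le> _")
proof -
  note int = integrable_mult_right[OF Forchheimer_gap_integral(1), of 2]
    integrable_mult_right[OF L3_space_integrable_power3[OF w], of 6]
    integrable_mult_right[OF L3_space_integrable_power3[OF v], of 2]
  have "?lhs \<le> (LINT x|lebesgue_on \<Omega>. 2 * gap x + 6 * norm (w x) ^ 3 + 2 * norm (v x) ^ 3)"
  proof (rule integral_mono[OF Forchheimer_weight_integrable[OF w]])
    show "integrable (lebesgue_on \<Omega>) (\<lambda>x. 2 * gap x + 6 * norm (w x) ^ 3 + 2 * norm (v x) ^ 3)"
      by (intro Bochner_Integration.integrable_add int)
    fix x
    define \<delta> where "\<delta> = norm (u x - v x)"
    have "\<delta> * \<delta>\<^sup>2 \<le> (norm (u x) + norm (v x)) * \<delta>\<^sup>2"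
      unfolding \<delta>_def by (intro mult_right_mono norm_triangle_ineq4) simp
    also have "\<dots> \<le> 2 * gap x"
      unfolding \<delta>_def by (rule norm_scaleR_strongly_monotone)
    finally have "\<delta> ^ 3 \<le> 2 * gap x" by (simp add: power2_eq_square power3_eq_cube mult.assoc)
    moreover have "\<delta> * norm (w x) * norm (w x) \<le> \<delta> ^ 3 + norm (w x) ^ 3 + norm (w x) ^ 3"
      and "norm (v x) * norm (w x) * norm (w x) \<le> norm (v x) ^ 3 + norm (w x) ^ 3 + norm (w x) ^ 3"
      by (rule mult3_le_sum_power3; simp add: \<delta>_def)+
    moreover have "(norm (u x) + norm (v x)) * norm (w x) * norm (w x)
        \<le> (\<delta> + 2 * norm (v x)) * norm (w x) * norm (w x)"
      using norm_triangle_sub[of "u x" "v x"] by (intro mult_right_mono) (auto simp: \<delta>_def)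
    ultimately show "(norm (u x) + norm (v x)) * norm (w x) * norm (w x)
        \<le> 2 * gap x + 6 * norm (w x) ^ 3 + 2 * norm (v x) ^ 3"
      unfolding distrib_right mult.assoc by linarith
  qed
  then show ?thesis
    using int by (simp add: Forchheimer_gap_integral(2))
qed

end

section \<open>Bounded domains and the weak divergence\<close>

locale bounded_open_domain =
  fixes \<Omega> :: "(real ^ 'd) set"
  assumes bounded_domain: "bounded \<Omega>" and open_domain: "open \<Omega>"
begin

abbreviation "M \<equiv> lebesgue_on \<Omega>"

lemma domain_lebesgue: "\<Omega> \<in> sets lebesgue"
  using open_domain by auto

sublocale finite_measure M
  using lmeasurable_open[OF bounded_domain open_domain] by (rule finite_measure_lebesgue_on)

lemma continuous_measurable:
  fixes h :: "real ^ 'd \<Rightarrow> 'b::euclidean_space"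
  shows "continuous_on UNIV h \<Longrightarrow> h \<in> borel_measurable M"
  using domain_lebesgue
  by (intro continuous_imp_measurable_on_sets_lebesgue) (auto intro: continuous_on_subset)

lemma continuous_integrable:
  fixes h :: "real ^ 'd \<Rightarrow> real"
  assumes "continuous_on UNIV h"
  shows "integrable M h"
proof -
  have "compact (h ` closure \<Omega>)"
    using bounded_domain assms by (intro compact_continuous_image)
        (auto intro: continuous_on_subset)
  then obtain C where "\<And>x. x \<in> closure \<Omega> \<Longrightarrow> norm (h x) \<le> C"
    using compact_imp_bounded by (metis bounded_iff imageI)
  then have "AE x in M. norm (h x) \<le> C"
    using closure_subset by (intro AE_I2) auto
  then show ?thesis
    using continuous_measurable[OF assms] by (rule integrable_const_bound)
qed

lemma continuous_L2_space: "continuous_on UNIV q \<Longrightarrow> q \<in> L2_space \<Omega>"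
  by (simp add: L2_space_def continuous_measurable continuous_integrable continuous_on_power)

lemma continuous_L3_space: "continuous_on UNIV v \<Longrightarrow> v \<in> L3_space \<Omega>"
  by (simp add: L3_space_def continuous_measurable continuous_integrable continuous_on_power
      continuous_on_norm)

lemma L2_space_integrable: "q \<in> L2_space \<Omega> \<Longrightarrow> integrable M q"
  using L2_space_integrable_mult[OF _ continuous_L2_space[of "\<lambda>x. 1"]] by simp

lemma L3_space_integrable_mult:
  assumes "v \<in> L3_space \<Omega>" and "w \<in> L3_space \<Omega>"
  shows "integrable M (\<lambda>x. norm (v x) * norm (w x))"
  using L3_space_integrable_mult3[OF assms continuous_L3_space[of "\<lambda>x. axis undefined 1"]]
  by (simp add: norm_axis_1)

lemma L3_space_integrable_inner:
  assumes "v \<in> L3_space \<Omega>" and "w \<in> L3_space \<Omega>"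
  shows "integrable M (\<lambda>x. v x \<bullet> w x)"
proof (rule Bochner_Integration.integrable_bound[OF L3_space_integrable_mult[OF assms]])
  show "(\<lambda>x. v x \<bullet> w x) \<in> borel_measurable M"
    using assms by (intro borel_measurable_inner L3_space_measurable)
qed (simp add: Cauchy_Schwarz_ineq2)

lemma L2_space_cong_AE:
  assumes p: "p \<in> L2_space \<Omega>" and eq: "AE x in M. p x = q x"
  shows "q \<in> L2_space \<Omega>"
proof -
  have "(\<lambda>x. if x \<in> \<Omega> then q x else 0) \<in> borel_measurable lebesgue"
  proof (rule borel_measurable_AE)
    show "(\<lambda>x. if x \<in> \<Omega> then p x else 0) \<in> borel_measurable lebesgue"
      using L2_space_measurable[OF p] domain_lebesgue by (simp add: borel_measurable_if)
    show "AE x in lebesgue. (if x \<in> \<Omega> then p x else 0) = (if x \<in> \<Omega> then q x else 0)"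
      using eq domain_lebesgue by (simp add: AE_restrict_space_iff)
  qed
  then have q: "q \<in> borel_measurable M"
    using domain_lebesgue by (simp add: borel_measurable_if)
  moreover have "integrable M (\<lambda>x. (q x)\<^sup>2)"
  proof (rule integrable_cong_AE_imp)
    show "integrable M (\<lambda>x. (p x)\<^sup>2)" using p by (simp add: L2_space_def)
    show "AE x in M. (p x)\<^sup>2 = (q x)\<^sup>2" using eq by eventually_elim simp
  qed (use q in simp)
  ultimately show ?thesis by (simp add: L2_space_def)
qed

lemma test_function_continuous:
  assumes "test_function \<Omega> \<phi>"
  shows "continuous_on UNIV \<phi>" and "continuous_on UNIV (grad \<phi>)"
proof -
  have Ck: "Ck k \<phi>" for k using assms by (simp add: test_function_def)
  show "continuous_on UNIV \<phi>" using Ck[of 0] by simp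
  have "continuous_on UNIV (\<lambda>x. \<chi> i. grad \<phi> x $ i)"
    using Ck[of "Suc 0"] by (intro continuous_on_vec_lambda) simp
  then show "continuous_on UNIV (grad \<phi>)" by simp
qed

lemma is_weak_div_add_scale:
  assumes "v \<in> L3_space \<Omega>" and "w \<in> L3_space \<Omega>" and "p \<in> L2_space \<Omega>" and "q \<in> L2_space \<Omega>"
    and "is_weak_div \<Omega> v p" and "is_weak_div \<Omega> w q"
  shows "is_weak_div \<Omega> (\<lambda>x. v x + t *\<^sub>R w x) (\<lambda>x. p x + t * q x)"
  unfolding is_weak_div_def
proof (intro allI impI)
  fix \<phi> assume \<phi>: "test_function \<Omega> \<phi>"
  note cont = continuous_L2_space[OF test_function_continuous(1)[OF \<phi>]]
    continuous_L3_space[OF test_function_continuous(2)[OF \<phi>]]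
  have "(LINT x|M. (v x + t *\<^sub>R w x) \<bullet> grad \<phi> x)
      = (LINT x|M. v x \<bullet> grad \<phi> x) + t * (LINT x|M. w x \<bullet> grad \<phi> x)"
    using assms(1,2) cont by (simp add: inner_add_left L3_space_integrable_inner)
  also have "\<dots> = - (LINT x|M. p x * \<phi> x) + t * - (LINT x|M. q x * \<phi> x)"
    using assms(5,6) \<phi> by (simp add: is_weak_div_def)
  also have "\<dots> = - (LINT x|M. (p x + t * q x) * \<phi> x)"
    using assms(3,4) cont by (simp add: distrib_right mult.assoc L2_space_integrable_mult)
  finally show "(LINT x|M. (v x + t *\<^sub>R w x) \<bullet> grad \<phi> x) = - (LINT x|M. (p x + t * q x) * \<phi> x)" .
qed

lemma is_weak_div_unique:
  assumes p: "p \<in> L2_space \<Omega>" "is_weak_div \<Omega> v p" and q: "q \<in> L2_space \<Omega>" "is_weak_div \<Omega> v q"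
  shows "AE x in M. p x = q x"
proof -
  have "AE x in M. p x - q x = 0"
  proof (rule fundamental_lemma_calculus_of_variations[OF open_domain])
    show "integrable M (\<lambda>x. p x - q x)"
      using p q by (intro Bochner_Integration.integrable_diff L2_space_integrable)
    fix \<phi> assume \<phi>: "test_function \<Omega> \<phi>"
    then have "\<phi> \<in> L2_space \<Omega>" by (intro continuous_L2_space test_function_continuous)
    then show "(LINT x|M. (p x - q x) * \<phi> x) = 0"
      using p q \<phi> by (simp add: left_diff_distrib L2_space_integrable_mult is_weak_div_def)
  qed
  then show ?thesis by simp
qed

end

lemma X_space_L3: "v \<in> X_space \<Omega> \<Longrightarrow> v \<in> L3_space \<Omega>"
  by (simp add: X_space_def)

lemma wdiv_is_weak_div:
  assumes "v \<in> X_space \<Omega>"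
  shows "wdiv \<Omega> v \<in> L2_space \<Omega>" and "is_weak_div \<Omega> v (wdiv \<Omega> v)"
proof -
  have "\<exists>w. w \<in> L2_space \<Omega> \<and> is_weak_div \<Omega> v w"
    using assms by (auto simp: X_space_def)
  from someI_ex[OF this] show "wdiv \<Omega> v \<in> L2_space \<Omega>" and "is_weak_div \<Omega> v (wdiv \<Omega> v)"
    by (simp_all add: wdiv_def)
qed

context bounded_open_domain
begin

lemma fn_subspace_X_space: "fn_subspace (X_space \<Omega>)"
proof (rule fn_subspaceI)
  have "is_weak_div \<Omega> (\<lambda>x. 0) (\<lambda>x. 0)" by (simp add: is_weak_div_def)
  then show "(\<lambda>x. 0) \<in> X_space \<Omega>"
    using fn_subspace_0[OF fn_subspace_L2_space] fn_subspace_0[OF fn_subspace_L3_space]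
    by (auto simp: X_space_def)
  fix v w t assume v: "v \<in> X_space \<Omega>" and w: "w \<in> X_space \<Omega>"
  have "(\<lambda>x. v x + t *\<^sub>R w x) \<in> L3_space \<Omega>"
    using fn_subspace_L3_space v[THEN X_space_L3] w[THEN X_space_L3]
    by (rule fn_subspace_add_scaleR)
  moreover have "(\<lambda>x. wdiv \<Omega> v x + t * wdiv \<Omega> w x) \<in> L2_space \<Omega>"
    using v w by (intro fn_subspace_add_scale fn_subspace_L2_space wdiv_is_weak_div)
  moreover have "is_weak_div \<Omega> (\<lambda>x. v x + t *\<^sub>R w x) (\<lambda>x. wdiv \<Omega> v x + t * wdiv \<Omega> w x)"
    using v w by (intro is_weak_div_add_scale X_space_L3 wdiv_is_weak_div)
  ultimately show "(\<lambda>x. v x + t *\<^sub>R w x) \<in> X_space \<Omega>"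
    unfolding X_space_def by blast
qed

lemma wdiv_add_scaleR:
  assumes v: "v \<in> X_space \<Omega>" and w: "w \<in> X_space \<Omega>"
  shows "AE x in M. wdiv \<Omega> (\<lambda>x. v x + t *\<^sub>R w x) x = wdiv \<Omega> v x + t * wdiv \<Omega> w x"
proof (rule is_weak_div_unique)
  have vw: "(\<lambda>x. v x + t *\<^sub>R w x) \<in> X_space \<Omega>"
    using fn_subspace_X_space v w by (rule fn_subspace_add_scaleR)
  then show "wdiv \<Omega> (\<lambda>x. v x + t *\<^sub>R w x) \<in> L2_space \<Omega>"
    and "is_weak_div \<Omega> (\<lambda>x. v x + t *\<^sub>R w x) (wdiv \<Omega> (\<lambda>x. v x + t *\<^sub>R w x))"
    by (rule wdiv_is_weak_div)+
  show "(\<lambda>x. wdiv \<Omega> v x + t * wdiv \<Omega> w x) \<in> L2_space \<Omega>"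
    using v w by (intro fn_subspace_add_scale fn_subspace_L2_space wdiv_is_weak_div)
  show "is_weak_div \<Omega> (\<lambda>x. v x + t *\<^sub>R w x) (\<lambda>x. wdiv \<Omega> v x + t * wdiv \<Omega> w x)"
    using v w by (intro is_weak_div_add_scale X_space_L3 wdiv_is_weak_div)
qed

lemma wdiv_diff:
  assumes "v \<in> X_space \<Omega>" and "w \<in> X_space \<Omega>"
  shows "AE x in M. wdiv \<Omega> (\<lambda>x. v x - w x) x = wdiv \<Omega> v x - wdiv \<Omega> w x"
  using wdiv_add_scaleR[OF assms, of "- 1"] by simp

end

section \<open>The Darcy--Forchheimer energy\<close>

lemma transpose_matrix_inv_symmetric:
  fixes K :: "real ^ 'd ^ 'd"
  assumes "transpose K = K" and "c > 0" and "\<And>\<xi>. (K *v \<xi>) \<bullet> \<xi> \<ge> c * (norm \<xi>)\<^sup>2"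
  shows "transpose (matrix_inv K) = matrix_inv K"
proof -
  have "\<xi> = 0" if "K *v \<xi> = 0" for \<xi>
  proof -
    have "c * (norm \<xi>)\<^sup>2 \<le> 0" using assms(3)[of \<xi>] that by simp
    then show ?thesis using \<open>c > 0\<close> by (simp add: mult_le_0_iff)
  qed
  then have "invertible K"
    by (simp add: invertible_left_inverse matrix_left_invertible_ker)
  then have inv: "K ** matrix_inv K = mat 1" "matrix_inv K ** K = mat 1"
    unfolding matrix_inv_def invertible_def by (metis (mono_tags, lifting) someI_ex)+
  then have "transpose (matrix_inv K) ** K = mat 1"
    by (metis assms(1) matrix_transpose_mul transpose_mat)
  then show ?thesis
    by (metis inv(1) matrix_mul_assoc matrix_mul_lid matrix_mul_rid)
qed

lemma bounded_bilinear_matrix_vector_mult: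
  "bounded_bilinear (\<lambda>(A :: real ^ 'n ^ 'm) x. A *v x)"
  unfolding bilinear_conv_bounded_bilinear[symmetric] bilinear_def
  by (auto intro!: linearI simp: matrix_vector_mult_add_rdistrib matrix_vector_right_distrib
      scaleR_matrix_vector_assoc matrix_vector_mult_scaleR)

definition Darcy_form ::
    "(real ^ 'd) set \<Rightarrow> (real ^ 'd \<Rightarrow> real ^ 'd ^ 'd) \<Rightarrow>
     (real ^ 'd \<Rightarrow> real ^ 'd) \<Rightarrow> (real ^ 'd \<Rightarrow> real ^ 'd) \<Rightarrow> real" where
  "Darcy_form \<Omega> K v w = (LINT x|lebesgue_on \<Omega>. (matrix_inv (K x) *v v x) \<bullet> w x)"

definition DF_form ::
    "(real ^ 'd) set \<Rightarrow> real \<Rightarrow> real \<Rightarrow> real \<Rightarrow> (real ^ 'd \<Rightarrow> real ^ 'd ^ 'd) \<Rightarrow>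
     (real ^ 'd \<Rightarrow> real ^ 'd) \<Rightarrow> (real ^ 'd \<Rightarrow> real ^ 'd) \<Rightarrow> real" where
  "DF_form \<Omega> \<mu> \<rho> \<beta> K v w = \<mu> / \<rho> * Darcy_form \<Omega> K v w + \<beta> / \<rho> * Forchheimer_form \<Omega> v w"

locale DF_data = bounded_open_domain \<Omega> for \<Omega> :: "(real ^ 'd) set" +
  fixes \<mu> \<rho> \<beta> :: real and K :: "real ^ 'd \<Rightarrow> real ^ 'd ^ 'd" and f :: "real ^ 'd \<Rightarrow> real ^ 'd"
  assumes viscosity_pos: "\<mu> > 0" and density_pos: "\<rho> > 0" and Forchheimer_coeff_nonneg: "\<beta> \<ge> 0"
    and permeability: "permeability_tensor \<Omega> K" and load: "bounded_load \<Omega> f"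
begin

abbreviation "F \<equiv> DF_energy \<Omega> \<mu> \<rho> \<beta> K f"
abbreviation "DF \<equiv> DF_form \<Omega> \<mu> \<rho> \<beta> K"

lemma Darcy_form_integrable:
  assumes v: "v \<in> L3_space \<Omega>" and w: "w \<in> L3_space \<Omega>"
  shows "integrable M (\<lambda>x. (matrix_inv (K x) *v v x) \<bullet> w x)"
proof -
  obtain C where A: "(\<lambda>x. matrix_inv (K x)) \<in> borel_measurable M"
      "AE x in M. norm (matrix_inv (K x)) \<le> C"
    using permeability by (auto simp: permeability_tensor_def Linfty_matrix_def)
  obtain k where "k > 0" and k: "\<And>(A :: real ^ 'd ^ 'd) \<xi>. norm (A *v \<xi>) \<le> norm A * norm \<xi> * k"
    using bounded_bilinear.pos_bounded[OF bounded_bilinear_matrix_vector_mult] by blast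
  show ?thesis
  proof (rule Bochner_Integration.integrable_bound)
    show "integrable M (\<lambda>x. C * k * (norm (v x) * norm (w x)))"
      using v w by (intro integrable_mult_right L3_space_integrable_mult)
    have "(\<lambda>x. matrix_inv (K x) *v v x) \<in> borel_measurable M"
      by (rule borel_measurable_continuous_Pair[OF A(1) L3_space_measurable[OF v]])
         (intro bounded_bilinear.continuous_on[OF bounded_bilinear_matrix_vector_mult]
           continuous_intros)
    then show "(\<lambda>x. (matrix_inv (K x) *v v x) \<bullet> w x) \<in> borel_measurable M"
      using L3_space_measurable[OF w] by (rule borel_measurable_inner)
    show "AE x in M. norm ((matrix_inv (K x) *v v x) \<bullet> w x)
        \<le> norm (C * k * (norm (v x) * norm (w x)))"
      using A(2)
    proof eventually_elim
      case (elim x)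
      have "\<bar>(matrix_inv (K x) *v v x) \<bullet> w x\<bar> \<le> norm (matrix_inv (K x) *v v x) * norm (w x)"
        by (rule Cauchy_Schwarz_ineq2)
      also have "\<dots> \<le> C * norm (v x) * k * norm (w x)"
        using elim \<open>k > 0\<close> by (intro mult_right_mono order_trans[OF k]) auto
      also have "\<dots> = C * k * (norm (v x) * norm (w x))" by simp
      finally show ?case by simp
    qed
  qed
qed

lemma Darcy_form_commute:
  assumes v: "v \<in> L3_space \<Omega>" and w: "w \<in> L3_space \<Omega>"
  shows "Darcy_form \<Omega> K v w = Darcy_form \<Omega> K w v"
proof -
  obtain c where "c > 0" and pos: "AE x in M. \<forall>\<xi>. (K x *v \<xi>) \<bullet> \<xi> \<ge> c * (norm \<xi>)\<^sup>2"
    using permeability by (auto simp: permeability_tensor_def uniformly_pos_def_def)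
  have "AE x in M. transpose (K x) = K x"
    using permeability by (simp add: permeability_tensor_def)
  with pos have "AE x in M. (matrix_inv (K x) *v v x) \<bullet> w x = (matrix_inv (K x) *v w x) \<bullet> v x"
  proof eventually_elim
    case (elim x)
    then have "transpose (matrix_inv (K x)) = matrix_inv (K x)"
      using \<open>c > 0\<close> by (intro transpose_matrix_inv_symmetric[of _ c]) auto
    then show ?case
      by (metis dot_lmul_matrix inner_commute vector_transpose_matrix)
  qed
  then show ?thesis
    unfolding Darcy_form_def using v w
    by (intro integral_cong_AE borel_measurable_integrable Darcy_form_integrable)
qed

lemma Darcy_form_add_scaleR_left:
  assumes "v \<in> L3_space \<Omega>" and "v' \<in> L3_space \<Omega>" and "w \<in> L3_space \<Omega>"
  shows "Darcy_form \<Omega> K (\<lambda>x. v x + t *\<^sub>R v' x) w = Darcy_form \<Omega> K v w + t * Darcy_form \<Omega> K v' w"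
  using assms
  by (simp add: Darcy_form_def matrix_vector_right_distrib matrix_vector_mult_scaleR inner_add_left
      Darcy_form_integrable)

lemma Darcy_form_diff_left:
  assumes "v \<in> L3_space \<Omega>" and "v' \<in> L3_space \<Omega>" and "w \<in> L3_space \<Omega>"
  shows "Darcy_form \<Omega> K (\<lambda>x. v x - v' x) w = Darcy_form \<Omega> K v w - Darcy_form \<Omega> K v' w"
  using Darcy_form_add_scaleR_left[OF assms, of "- 1"] by simp

lemma Darcy_form_quadratic:
  assumes v: "v \<in> L3_space \<Omega>" and w: "w \<in> L3_space \<Omega>"
  shows "Darcy_form \<Omega> K (\<lambda>x. v x + t *\<^sub>R w x) (\<lambda>x. v x + t *\<^sub>R w x)
    = Darcy_form \<Omega> K v v + 2 * t * Darcy_form \<Omega> K v w + t\<^sup>2 * Darcy_form \<Omega> K w w"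
proof -
  have vw: "(\<lambda>x. v x + t *\<^sub>R w x) \<in> L3_space \<Omega>"
    using fn_subspace_L3_space v w by (rule fn_subspace_add_scaleR)
  show ?thesis
    by (simp add: Darcy_form_add_scaleR_left v w vw Darcy_form_commute[OF _ vw]
        Darcy_form_commute[OF w v] power2_eq_square algebra_simps)
qed

lemma Darcy_form_nonneg: "0 \<le> Darcy_form \<Omega> K v v"
proof -
  obtain c where "c > 0" and "AE x in M. \<forall>\<xi>. (matrix_inv (K x) *v \<xi>) \<bullet> \<xi> \<ge> c * (norm \<xi>)\<^sup>2"
    using permeability by (auto simp: permeability_tensor_def uniformly_pos_def_def)
  then have "AE x in M. 0 \<le> (matrix_inv (K x) *v v x) \<bullet> v x"
    by (elim eventually_mono) (metis less_imp_le mult_nonneg_nonneg order_trans zero_le_power2)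
  then show ?thesis unfolding Darcy_form_def by (rule integral_nonneg_AE)
qed

lemma Darcy_form_Cauchy_Schwarz:
  assumes "v \<in> L3_space \<Omega>" and "w \<in> L3_space \<Omega>"
  shows "(Darcy_form \<Omega> K v w)\<^sup>2 \<le> Darcy_form \<Omega> K v v * Darcy_form \<Omega> K w w"
proof (rule nonneg_quadratic_discriminant[OF _ Darcy_form_nonneg])
  show "0 \<le> Darcy_form \<Omega> K v v + 2 * t * Darcy_form \<Omega> K v w + t\<^sup>2 * Darcy_form \<Omega> K w w" for t
    using Darcy_form_nonneg[of "\<lambda>x. v x + t *\<^sub>R w x"] by (simp add: Darcy_form_quadratic assms)
qed

lemma DF_energy_eq:
  "F v = \<mu> / (2 * \<rho>) * Darcy_form \<Omega> K v v
    + \<beta> / (3 * \<rho>) * (LINT x|M. norm (v x) ^ 3) - (LINT x|M. f x \<bullet> v x)"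
  by (simp add: DF_energy_def Darcy_form_def)

lemma load_integrable: "v \<in> X_space \<Omega> \<Longrightarrow> integrable M (\<lambda>x. f x \<bullet> v x)"
  using load by (simp add: bounded_load_def)

lemma DF_energy_has_derivative:
  assumes v: "v \<in> X_space \<Omega>" and w: "w \<in> X_space \<Omega>"
  shows "((\<lambda>t. F (\<lambda>x. v x + t *\<^sub>R w x)) has_real_derivative DF v w - (LINT x|M. f x \<bullet> w x)) (at 0)"
proof -
  note L3 = v[THEN X_space_L3] w[THEN X_space_L3]
  have "(LINT x|M. f x \<bullet> (v x + t *\<^sub>R w x))
      = (LINT x|M. f x \<bullet> v x) + t * (LINT x|M. f x \<bullet> w x)" for t
    using v w by (simp add: inner_add_right load_integrable)
  note expand = DF_energy_eq Darcy_form_quadratic[OF L3] this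
  show ?thesis
    unfolding expand
    by (rule derivative_eq_intros integral_norm_power3_has_derivative[OF L3] refl)+
       (use density_pos in \<open>simp add: DF_form_def field_simps\<close>)
qed

lemma bregman_sym_DF_energy:
  assumes "v \<in> X_space \<Omega>" and "w \<in> X_space \<Omega>"
  shows "bregman_sym F v w = DF v (\<lambda>x. v x - w x) - DF w (\<lambda>x. v x - w x)"
proof -
  have d: "(\<lambda>x. v x - w x) \<in> X_space \<Omega>"
    using fn_subspace_X_space assms by (rule fn_subspace_diff)
  show ?thesis
    using DF_energy_has_derivative[OF assms(1) d] DF_energy_has_derivative[OF assms(2) d]
    by (simp add: bregman_sym_def gateaux_deriv_def DERIV_imp_deriv)
qed

lemma bregman_sym_eq_gaps:
  assumes "v \<in> X_space \<Omega>" and "w \<in> X_space \<Omega>"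
  shows "bregman_sym F v w = \<mu> / \<rho> * Darcy_form \<Omega> K (\<lambda>x. v x - w x) (\<lambda>x. v x - w x)
    + \<beta> / \<rho> * Forchheimer_gap \<Omega> v w"
  using assms[THEN X_space_L3]
  by (simp add: bregman_sym_DF_energy assms DF_form_def Forchheimer_gap_def Darcy_form_diff_left
      fn_subspace_diff[OF fn_subspace_L3_space] algebra_simps)

lemma bregman_sym_ge_gaps:
  assumes "v \<in> X_space \<Omega>" and "w \<in> X_space \<Omega>"
  shows "\<mu> / \<rho> * Darcy_form \<Omega> K (\<lambda>x. v x - w x) (\<lambda>x. v x - w x) \<le> bregman_sym F v w"
    and "\<beta> / \<rho> * Forchheimer_gap \<Omega> v w \<le> bregman_sym F v w"
    and "0 \<le> bregman_sym F v w"
proof -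
  have "0 \<le> \<mu> / \<rho> * Darcy_form \<Omega> K (\<lambda>x. v x - w x) (\<lambda>x. v x - w x)"
    using viscosity_pos density_pos by (simp add: Darcy_form_nonneg)
  moreover have "0 \<le> \<beta> / \<rho> * Forchheimer_gap \<Omega> v w"
    using density_pos Forchheimer_coeff_nonneg Forchheimer_gap_nonneg[OF assms[THEN X_space_L3]]
    by simp
  ultimately show "\<mu> / \<rho> * Darcy_form \<Omega> K (\<lambda>x. v x - w x) (\<lambda>x. v x - w x) \<le> bregman_sym F v w"
    and "\<beta> / \<rho> * Forchheimer_gap \<Omega> v w \<le> bregman_sym F v w" and "0 \<le> bregman_sym F v w"
    unfolding bregman_sym_eq_gaps[OF assms] by linarith+
qed

lemma Darcy_form_diff_le_bregman_sym:
  assumes u: "u \<in> X_space \<Omega>" and v: "v \<in> X_space \<Omega>" and w: "w \<in> X_space \<Omega>"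
  shows "(\<mu> / \<rho> * (Darcy_form \<Omega> K u w - Darcy_form \<Omega> K v w))\<^sup>2
    \<le> \<mu> / \<rho> * Darcy_form \<Omega> K w w * bregman_sym F u v"
proof -
  define \<alpha> where "\<alpha> = \<mu> / \<rho>"
  define Q where "Q = Darcy_form \<Omega> K (\<lambda>x. u x - v x) (\<lambda>x. u x - v x)"
  note L3 = u[THEN X_space_L3] v[THEN X_space_L3] w[THEN X_space_L3]
  have "(\<alpha> * (Darcy_form \<Omega> K u w - Darcy_form \<Omega> K v w))\<^sup>2 \<le> \<alpha>\<^sup>2 * (Q * Darcy_form \<Omega> K w w)"
    using Darcy_form_Cauchy_Schwarz[OF fn_subspace_diff[OF fn_subspace_L3_space L3(1,2)] L3(3)]
    unfolding power_mult_distrib Q_def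
    by (intro mult_left_mono) (simp_all add: Darcy_form_diff_left L3)
  also have "\<dots> = \<alpha> * Darcy_form \<Omega> K w w * (\<alpha> * Q)"
    by (simp add: power2_eq_square)
  also have "\<dots> \<le> \<alpha> * Darcy_form \<Omega> K w w * bregman_sym F u v"
    unfolding \<alpha>_def Q_def using viscosity_pos density_pos
    by (intro mult_left_mono bregman_sym_ge_gaps u v mult_nonneg_nonneg Darcy_form_nonneg) simp
  finally show ?thesis by (simp add: \<alpha>_def)
qed

lemma Forchheimer_form_diff_le_bregman_sym:
  assumes u: "u \<in> X_space \<Omega>" and v: "v \<in> X_space \<Omega>" and w: "w \<in> X_space \<Omega>"
  shows "(\<beta> / \<rho> * (Forchheimer_form \<Omega> u w - Forchheimer_form \<Omega> v w))\<^sup>2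
    \<le> 2 * bregman_sym F u v * (2 * bregman_sym F u v
      + \<beta> / \<rho> * (6 * (LINT x|M. norm (w x) ^ 3) + 2 * (LINT x|M. norm (v x) ^ 3)))"
proof -
  define \<gamma> where "\<gamma> = \<beta> / \<rho>"
  define G where "G = Forchheimer_gap \<Omega> u v"
  define C where "C = 6 * (LINT x|M. norm (w x) ^ 3) + 2 * (LINT x|M. norm (v x) ^ 3)"
  note L3 = u[THEN X_space_L3] v[THEN X_space_L3] w[THEN X_space_L3]
  have nonneg: "\<gamma> \<ge> 0" "G \<ge> 0" "C \<ge> 0"
    using density_pos Forchheimer_coeff_nonneg Forchheimer_gap_nonneg[OF L3(1,2)]
    by (simp_all add: \<gamma>_def G_def C_def)
  have gap: "\<gamma> * G \<le> bregman_sym F u v" "0 \<le> bregman_sym F u v"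
    unfolding \<gamma>_def G_def using u v by (rule bregman_sym_ge_gaps)+
  have "(Forchheimer_form \<Omega> u w - Forchheimer_form \<Omega> v w)\<^sup>2 \<le> 2 * G * (2 * G + C)"
    using Forchheimer_form_diff_power2_le[OF L3]
      mult_left_mono[OF Forchheimer_weight_integral_le[OF L3], of "2 * G"] nonneg
    unfolding G_def C_def by (simp add: add.assoc)
  then have "(\<gamma> * (Forchheimer_form \<Omega> u w - Forchheimer_form \<Omega> v w))\<^sup>2
      \<le> \<gamma>\<^sup>2 * (2 * G * (2 * G + C))"
    unfolding power_mult_distrib by (rule mult_left_mono) simp
  also have "\<dots> = 2 * (\<gamma> * G) * (2 * (\<gamma> * G) + \<gamma> * C)"
    by (simp add: power2_eq_square algebra_simps)
  also have "\<dots> \<le> 2 * bregman_sym F u v * (2 * bregman_sym F u v + \<gamma> * C)"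
    using gap nonneg by (intro mult_mono add_right_mono mult_left_mono) auto
  finally show ?thesis by (simp add: \<gamma>_def C_def)
qed

lemma DF_form_diff_le_bregman_sym:
  assumes v: "v \<in> X_space \<Omega>" and w: "w \<in> X_space \<Omega>"
  shows "\<exists>B\<ge>0. \<forall>u\<in>X_space \<Omega>. (DF u w - DF v w)\<^sup>2 \<le> B * (bregman_sym F u v + (bregman_sym F u v)\<^sup>2)"
proof -
  define P where "P = \<mu> / \<rho> * Darcy_form \<Omega> K w w"
  define C where "C = \<beta> / \<rho> * (6 * (LINT x|M. norm (w x) ^ 3) + 2 * (LINT x|M. norm (v x) ^ 3))"
  have nonneg: "P \<ge> 0" "C \<ge> 0"
    using viscosity_pos density_pos Forchheimer_coeff_nonneg
    by (simp_all add: P_def C_def Darcy_form_nonneg)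
  have "(DF u w - DF v w)\<^sup>2 \<le> (2 * P + 4 * C + 8) * (bregman_sym F u v + (bregman_sym F u v)\<^sup>2)"
    if u: "u \<in> X_space \<Omega>" for u
  proof -
    define X where "X = \<mu> / \<rho> * (Darcy_form \<Omega> K u w - Darcy_form \<Omega> K v w)"
    define Y where "Y = \<beta> / \<rho> * (Forchheimer_form \<Omega> u w - Forchheimer_form \<Omega> v w)"
    define D where "D = bregman_sym F u v"
    have "D \<ge> 0" unfolding D_def using u v by (rule bregman_sym_ge_gaps)
    have "(DF u w - DF v w)\<^sup>2 = (X + Y)\<^sup>2"
      by (simp add: DF_form_def X_def Y_def algebra_simps)
    also have "\<dots> \<le> 2 * X\<^sup>2 + 2 * Y\<^sup>2"
      using sum_squares_bound[of X Y] unfolding power2_sum by linarith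
    also have "\<dots> \<le> 2 * (P * D) + 2 * (2 * D * (2 * D + C))"
      using Darcy_form_diff_le_bregman_sym[OF u v w] Forchheimer_form_diff_le_bregman_sym[OF u v w]
      unfolding X_def Y_def D_def P_def C_def by (intro add_mono mult_left_mono) auto
    also have "\<dots> \<le> (2 * P + 4 * C + 8) * (D + D\<^sup>2)"
    proof -
      have "0 \<le> 2 * P * D\<^sup>2 + 4 * C * D\<^sup>2 + 8 * D" using nonneg \<open>D \<ge> 0\<close> by simp
      then show ?thesis by (simp add: power2_eq_square algebra_simps)
    qed
    finally show ?thesis by (simp add: D_def)
  qed
  then show ?thesis using nonneg by (intro exI[of _ "2 * P + 4 * C + 8"]) auto
qed

end

section \<open>Raviart--Thomas-type pairs\<close>

lemma fn_subspace_piecewise: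
  assumes "fn_subspace V" and local: "\<And>T. T \<in> \<T> \<Longrightarrow> fn_subspace (S T)"
  shows "fn_subspace {v \<in> V. \<forall>T\<in>\<T>. \<exists>w\<in>S T. AE x in N. x \<in> T \<longrightarrow> v x = w x}"
proof (rule fn_subspaceI)
  show "(\<lambda>x. 0) \<in> {v \<in> V. \<forall>T\<in>\<T>. \<exists>w\<in>S T. AE x in N. x \<in> T \<longrightarrow> v x = w x}"
    using assms fn_subspace_0 by (auto intro: bexI[of _ "\<lambda>x. 0"])
  fix v w t
  assume vw: "v \<in> {v \<in> V. \<forall>T\<in>\<T>. \<exists>w\<in>S T. AE x in N. x \<in> T \<longrightarrow> v x = w x}"
    "w \<in> {v \<in> V. \<forall>T\<in>\<T>. \<exists>w\<in>S T. AE x in N. x \<in> T \<longrightarrow> v x = w x}"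
  have "\<exists>z\<in>S T. AE x in N. x \<in> T \<longrightarrow> v x + t *\<^sub>R w x = z x" if T: "T \<in> \<T>" for T
  proof -
    obtain v' w' where "v' \<in> S T" "w' \<in> S T"
      and v': "AE x in N. x \<in> T \<longrightarrow> v x = v' x" and w': "AE x in N. x \<in> T \<longrightarrow> w x = w' x"
      using vw T by blast
    from v' w' have "AE x in N. x \<in> T \<longrightarrow> v x + t *\<^sub>R w x = v' x + t *\<^sub>R w' x"
      by eventually_elim simp
    then show ?thesis
      using fn_subspace_add_scaleR[OF local[OF T] \<open>v' \<in> S T\<close> \<open>w' \<in> S T\<close>] by (rule bexI)
  qed
  then show "(\<lambda>x. v x + t *\<^sub>R w x) \<in> {v \<in> V. \<forall>T\<in>\<T>. \<exists>w\<in>S T. AE x in N. x \<in> T \<longrightarrow> v x = w x}"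
    using vw fn_subspace_add_scaleR[OF assms(1)] by auto
qed

lemma fn_subspace_local_polynomial_space: "local_polynomial_space S \<Longrightarrow> fn_subspace S"
  by (auto simp: local_polynomial_space_def fn_subspace_fn_span)

locale RT_pair = bounded_open_domain \<Omega> for \<Omega> :: "(real ^ 'd) set" +
  fixes \<T> :: "(real ^ 'd) set set" and Xh :: "(real ^ 'd \<Rightarrow> real ^ 'd) set"
    and Mh :: "(real ^ 'd \<Rightarrow> real) set"
  assumes partition: "partition_of_domain \<Omega> \<T>" and pair: "RT_type_pair \<Omega> \<T> Xh Mh"
begin

lemma finite_partition: "finite \<T>"
  using partition by (simp add: partition_of_domain_def)

lemma polytope_element: "T \<in> \<T> \<Longrightarrow> polytope T"
  using partition by (simp add: partition_of_domain_def)

lemma AE_unique_element: "AE x in M. \<exists>T\<in>\<T>. x \<in> T \<and> (\<forall>S\<in>\<T>. x \<in> S \<longrightarrow> S = T)"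
proof -
  have "AE x in M. x \<notin> frontier T" if "T \<in> \<T>" for T
  proof -
    have "frontier T \<in> null_sets lebesgue"
      using polytope_element[OF that] polytope_imp_convex negligible_convex_frontier
      by (auto simp: negligible_iff_null_sets)
    then have "AE x in lebesgue. x \<notin> frontier T" by (rule AE_not_in)
    then show ?thesis
      using domain_lebesgue by (subst AE_restrict_space_iff) auto
  qed
  then have "AE x in M. \<forall>T\<in>\<T>. x \<notin> frontier T"
    using finite_partition by (simp add: AE_finite_all)
  then show ?thesis
    using AE_space
  proof eventually_elim
    case (elim x)
    then have "x \<in> \<Union>\<T>"
      using partition closure_subset[of \<Omega>] by (auto simp: partition_of_domain_def)
    moreover have "x \<in> interior T" if "T \<in> \<T>" "x \<in> T" for T
      using that elim(1) closure_subset by (auto simp: frontier_def)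
    moreover have "S = T" if "S \<in> \<T>" "T \<in> \<T>" "x \<in> interior S" "x \<in> interior T" for S T
      using partition that unfolding partition_of_domain_def by (metis IntI empty_iff)
    ultimately show ?case by (meson UnionE)
  qed
qed

lemma velocity_local_spaces:
  obtains XT where "\<And>T. T \<in> \<T> \<Longrightarrow> local_polynomial_space (XT T)"
    and "Xh = fe_velocity_space \<Omega> \<T> XT"
  using pair unfolding RT_type_pair_def by blast

lemma pressure_local_spaces:
  obtains MT where "\<And>T. T \<in> \<T> \<Longrightarrow> local_polynomial_space (MT T)"
    and "Mh = fe_pressure_space \<Omega> \<T> MT"
  using pair unfolding RT_type_pair_def by blast

lemma Xh_X_space: "v \<in> Xh \<Longrightarrow> v \<in> X_space \<Omega>"
  by (rule velocity_local_spaces) (auto simp: fe_velocity_space_def)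

lemma Mh_L2_space: "q \<in> Mh \<Longrightarrow> q \<in> L2_space \<Omega>"
  by (rule pressure_local_spaces) (auto simp: fe_pressure_space_def)

lemma fn_subspace_Xh: "fn_subspace Xh"
proof (rule velocity_local_spaces)
  fix XT assume "\<And>T. T \<in> \<T> \<Longrightarrow> local_polynomial_space (XT T)" "Xh = fe_velocity_space \<Omega> \<T> XT"
  then show ?thesis
    unfolding fe_velocity_space_def
    by (simp add: fn_subspace_piecewise fn_subspace_X_space fn_subspace_local_polynomial_space)
qed

lemma fn_subspace_Mh: "fn_subspace Mh"
proof (rule pressure_local_spaces)
  fix MT assume "\<And>T. T \<in> \<T> \<Longrightarrow> local_polynomial_space (MT T)" "Mh = fe_pressure_space \<Omega> \<T> MT"
  then show ?thesis
    unfolding fe_pressure_space_def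
    by (simp add: fn_subspace_piecewise fn_subspace_L2_space fn_subspace_local_polynomial_space)
qed

lemma Mh_cong_AE:
  assumes q: "q \<in> Mh" and eq: "AE x in M. q x = r x"
  shows "r \<in> Mh"
proof (rule pressure_local_spaces)
  fix MT assume Mh: "Mh = fe_pressure_space \<Omega> \<T> MT"
  have "\<exists>s\<in>MT T. AE x in M. x \<in> T \<longrightarrow> r x = s x" if T: "T \<in> \<T>" for T
  proof -
    obtain s where "s \<in> MT T" and s: "AE x in M. x \<in> T \<longrightarrow> q x = s x"
      using q T unfolding Mh fe_pressure_space_def by blast
    from s eq have "AE x in M. x \<in> T \<longrightarrow> r x = s x" by eventually_elim simp
    then show ?thesis using \<open>s \<in> MT T\<close> by (rule bexI)
  qed
  then show ?thesis
    using L2_space_cong_AE[OF Mh_L2_space[OF q] eq] by (simp add: Mh fe_pressure_space_def)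
qed

lemma wdiv_Xh: "v \<in> Xh \<Longrightarrow> wdiv \<Omega> v \<in> Mh"
  using pair by (simp add: RT_type_pair_def)

lemma wdiv_onto_Mh: "q \<in> Mh \<Longrightarrow> \<exists>v\<in>Xh. AE x in M. wdiv \<Omega> v x = q x"
  using pair by (simp add: RT_type_pair_def)

lemma truncated_polynomial_in_Mh:
  assumes MT: "\<And>T. T \<in> \<T> \<Longrightarrow> local_polynomial_space (MT T)" and Mh: "Mh = fe_pressure_space \<Omega> \<T> MT"
    and T: "T \<in> \<T>" and p: "p \<in> MT T"
  shows "(\<lambda>x. if x \<in> T then p x else 0) \<in> Mh"
proof -
  have "continuous_on UNIV p"
    using MT[OF T] p by (intro continuous_on_polymonial_function)
        (simp add: local_polynomial_space_def)
  then have pL2: "p \<in> L2_space \<Omega>" by (rule continuous_L2_space)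
  have "T \<in> sets borel"
    using polytope_element[OF T] by (intro borel_closed polytope_imp_closed)
  then have "T \<inter> \<Omega> \<in> sets M"
    using domain_lebesgue by (auto simp: sets_restrict_space_iff)
  moreover have "(indicat_real S x * p x)\<^sup>2 = indicat_real S x *\<^sub>R (p x)\<^sup>2" for S x
    by (simp add: indicator_def)
  ultimately have "(\<lambda>x. indicat_real (T \<inter> \<Omega>) x * p x) \<in> L2_space \<Omega>"
    using pL2 L2_space_measurable[OF pL2] unfolding L2_space_def
    by (simp add: integrable_mult_indicator borel_measurable_times borel_measurable_indicator
        del: real_scaleR_def)
  moreover have "AE x in M. indicat_real (T \<inter> \<Omega>) x * p x = (if x \<in> T then p x else 0)"
    using AE_space by eventually_elim simp
  ultimately have "(\<lambda>x. if x \<in> T then p x else 0) \<in> L2_space \<Omega>"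
    by (rule L2_space_cong_AE)
  moreover have "\<exists>r\<in>MT S. AE x in M. x \<in> S \<longrightarrow> (if x \<in> T then p x else 0) = r x" if S: "S \<in> \<T>" for S
  proof
    show "(if S = T then p else (\<lambda>x. 0)) \<in> MT S"
      using p fn_subspace_0[OF fn_subspace_local_polynomial_space[OF MT[OF S]]] by simp
    show "AE x in M. x \<in> S \<longrightarrow> (if x \<in> T then p x else 0) = (if S = T then p else (\<lambda>x. 0)) x"
      using AE_unique_element by eventually_elim (use S T in auto)
  qed
  ultimately show ?thesis by (simp add: Mh fe_pressure_space_def)
qed

lemma sum_truncated_eq_local_sum:
  assumes B: "\<And>T. T \<in> \<T> \<Longrightarrow> finite (B T)"
    and T: "T \<in> \<T>" "x \<in> T" "\<And>S. S \<in> \<T> \<Longrightarrow> x \<in> S \<Longrightarrow> S = T"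
  shows "(\<Sum>(S, p)\<in>Sigma \<T> B. c S p * (if x \<in> S then p x else 0)) = (\<Sum>p\<in>B T. c T p * p x :: real)"
proof -
  have mem: "x \<in> S \<longleftrightarrow> S = T" if "S \<in> \<T>" for S using T that by blast
  have "(\<Sum>(S, p)\<in>Sigma \<T> B. c S p * (if x \<in> S then p x else 0))
      = (\<Sum>S\<in>\<T>. \<Sum>p\<in>B S. c S p * (if x \<in> S then p x else 0))"
    using finite_partition B by (subst sum.Sigma) auto
  also have "\<dots> = (\<Sum>S\<in>\<T>. if S = T then \<Sum>p\<in>B T. c T p * p x else 0)"
    by (rule sum.cong) (simp_all add: mem)
  also have "\<dots> = (\<Sum>p\<in>B T. c T p * p x)" using T(1) finite_partition by simp
  finally show ?thesis .
qed

lemma Mh_finitely_spanned: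
  obtains J :: "((real ^ 'd) set \<times> (real ^ 'd \<Rightarrow> real)) set" and b
  where "finite J" and "\<And>j. j \<in> J \<Longrightarrow> b j \<in> Mh"
    and "\<And>e. e \<in> Mh \<Longrightarrow> \<exists>c. AE x in M. e x = (\<Sum>j\<in>J. c j * b j x)"
proof (rule pressure_local_spaces)
  fix MT assume MT: "\<And>T. T \<in> \<T> \<Longrightarrow> local_polynomial_space (MT T)"
      and Mh: "Mh = fe_pressure_space \<Omega> \<T> MT"
  then have "\<forall>T\<in>\<T>. \<exists>B. finite B \<and> MT T = fn_span B"
    by (simp add: local_polynomial_space_def)
  from bchoice[OF this] obtain B
    where B: "\<And>T. T \<in> \<T> \<Longrightarrow> finite (B T)" "\<And>T. T \<in> \<T> \<Longrightarrow> MT T = fn_span (B T)"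
    by blast
  define b where "b = (\<lambda>(T :: (real ^ 'd) set, p) x. if x \<in> T then p x else (0::real))"
  show thesis
  proof (rule that[of "Sigma \<T> B" b])
    show "finite (Sigma \<T> B)" using B(1) finite_partition by auto
    show "b j \<in> Mh" if "j \<in> Sigma \<T> B" for j
      using that truncated_polynomial_in_Mh[OF MT Mh] fn_span_base[OF B(1)] B(2)
      by (auto simp: b_def)
  next
    fix e assume "e \<in> Mh"
    then have "\<forall>T\<in>\<T>. \<exists>c. AE x in M. x \<in> T \<longrightarrow> e x = (\<Sum>p\<in>B T. c p * p x)"
      using B(2) by (fastforce simp: Mh fe_pressure_space_def fn_span_def)
    from bchoice[OF this] obtain c where
      "\<forall>T\<in>\<T>. AE x in M. x \<in> T \<longrightarrow> e x = (\<Sum>p\<in>B T. c T p * p x)" ..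
    then have "AE x in M. \<forall>T\<in>\<T>. x \<in> T \<longrightarrow> e x = (\<Sum>p\<in>B T. c T p * p x)"
      using finite_partition by (simp add: AE_finite_all)
    with AE_unique_element have "AE x in M. e x = (\<Sum>j\<in>Sigma \<T> B. case_prod c j * b j x)"
    proof eventually_elim
      case (elim x)
      then obtain T where T: "T \<in> \<T>" "x \<in> T" "\<And>S. S \<in> \<T> \<Longrightarrow> x \<in> S \<Longrightarrow> S = T" by blast
      have "(\<Sum>j\<in>Sigma \<T> B. case_prod c j * b j x)
          = (\<Sum>(S, p)\<in>Sigma \<T> B. c S p * (if x \<in> S then p x else 0))"
        by (rule sum.cong) (auto simp: b_def)
      then show ?case
        using sum_truncated_eq_local_sum[where c = c, OF B(1) T] elim(2) T(1,2) by simp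
    qed
    then show "\<exists>c. AE x in M. e x = (\<Sum>j\<in>Sigma \<T> B. c j * b j x)" by blast
  qed
qed

lemma Mh_norm_eq_sum_divergences:
  obtains J :: "((real ^ 'd) set \<times> (real ^ 'd \<Rightarrow> real)) set" and v
  where "finite J" and "\<And>j. j \<in> J \<Longrightarrow> v j \<in> Xh"
    and "\<And>e. e \<in> Mh \<Longrightarrow> (L2_norm \<Omega> e)\<^sup>2 = (\<Sum>j\<in>J. (L2_inner \<Omega> e (wdiv \<Omega> (v j)))\<^sup>2)"
proof -
  obtain J :: "((real ^ 'd) set \<times> (real ^ 'd \<Rightarrow> real)) set" and b where J: "finite J"
    and b: "\<And>j. j \<in> J \<Longrightarrow> b j \<in> Mh"
    and span: "\<And>e. e \<in> Mh \<Longrightarrow> \<exists>c. AE x in M. e x = (\<Sum>j\<in>J. c j * b j x)"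
    using Mh_finitely_spanned by blast
  obtain n where n: "\<And>j. j \<in> J \<Longrightarrow> n j \<in> Mh"
    and Parseval: "\<And>e. e \<in> Mh \<Longrightarrow> (L2_norm \<Omega> e)\<^sup>2 = (\<Sum>j\<in>J. (L2_inner \<Omega> e (n j))\<^sup>2)"
    using L2_Parseval_family[where b = b, OF J fn_subspace_Mh _ b span] Mh_L2_space by blast
  have "\<forall>j\<in>J. \<exists>v. v \<in> Xh \<and> (AE x in M. wdiv \<Omega> v x = n j x)"
    using n wdiv_onto_Mh by blast
  from bchoice[OF this] obtain v
    where v: "\<And>j. j \<in> J \<Longrightarrow> v j \<in> Xh" "\<And>j. j \<in> J \<Longrightarrow> AE x in M. wdiv \<Omega> (v j) x = n j x"
    by blast
  have "L2_inner \<Omega> e (wdiv \<Omega> (v j)) = L2_inner \<Omega> e (n j)" if "e \<in> Mh" "j \<in> J" for e j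
    unfolding L2_inner_commute[of \<Omega> e] using that v n
    by (intro L2_inner_cong_AE Mh_L2_space wdiv_Xh)
  with Parseval have "(L2_norm \<Omega> e)\<^sup>2 = (\<Sum>j\<in>J. (L2_inner \<Omega> e (wdiv \<Omega> (v j)))\<^sup>2)" if "e \<in> Mh" for e
    using that by simp
  with J v(1) show thesis by (rule that)
qed

end

section \<open>The augmented Lagrangian method\<close>

definition augmented_Lagrangian ::
    "(real ^ 'd) set \<Rightarrow> ((real ^ 'd \<Rightarrow> real ^ 'd) \<Rightarrow> real) \<Rightarrow> (real ^ 'd \<Rightarrow> real) \<Rightarrow> real \<Rightarrow>
     (real ^ 'd \<Rightarrow> real) \<Rightarrow> (real ^ 'd \<Rightarrow> real ^ 'd) \<Rightarrow> real" where
  "augmented_Lagrangian \<Omega> F gh \<epsilon> p v =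
     F v - L2_inner \<Omega> p (wdiv \<Omega> v) + 1 / (2 * \<epsilon>) * (L2_norm \<Omega> (\<lambda>x. wdiv \<Omega> v x - gh x))\<^sup>2"

lemma ALM_sequence_augmented_Lagrangian:
  "ALM_sequence \<Omega> F Xh gh \<epsilon> p0 u p \<longleftrightarrow>
    p 0 = p0 \<and>
    (\<forall>n. is_arg_min (augmented_Lagrangian \<Omega> F gh \<epsilon> (p n)) (\<lambda>v. v \<in> Xh) (u (Suc n)) \<and>
      (AE x in lebesgue_on \<Omega>. p (Suc n) x = p n x - inverse \<epsilon> * (wdiv \<Omega> (u (Suc n)) x - gh x)))"
  by (simp add: ALM_sequence_def augmented_Lagrangian_def[abs_def] L2_inner_def L2_norm_def)

context DF_data
begin

lemma augmented_Lagrangian_on_line: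
  assumes u: "u \<in> X_space \<Omega>" and v: "v \<in> X_space \<Omega>" and p: "p \<in> L2_space \<Omega>"
    and gh: "gh \<in> L2_space \<Omega>"
  shows "augmented_Lagrangian \<Omega> F gh \<epsilon> p (\<lambda>x. u x + t *\<^sub>R v x) = F (\<lambda>x. u x + t *\<^sub>R v x)
    - (L2_inner \<Omega> p (wdiv \<Omega> u) + t * L2_inner \<Omega> p (wdiv \<Omega> v))
    + 1 / (2 * \<epsilon>) * ((L2_norm \<Omega> (\<lambda>x. wdiv \<Omega> u x - gh x))\<^sup>2
      + 2 * t * L2_inner \<Omega> (\<lambda>x. wdiv \<Omega> u x - gh x) (wdiv \<Omega> v) + t\<^sup>2 * (L2_norm \<Omega> (wdiv \<Omega> v))\<^sup>2)"
proof -
  note du = wdiv_is_weak_div(1)[OF u] and dv = wdiv_is_weak_div(1)[OF v]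
  have duv: "wdiv \<Omega> (\<lambda>x. u x + t *\<^sub>R v x) \<in> L2_space \<Omega>"
    using u v by (intro wdiv_is_weak_div(1) fn_subspace_add_scaleR fn_subspace_X_space)
  have "L2_inner \<Omega> (wdiv \<Omega> (\<lambda>x. u x + t *\<^sub>R v x)) p
      = L2_inner \<Omega> (\<lambda>x. wdiv \<Omega> u x + t * wdiv \<Omega> v x) p"
    by (rule L2_inner_cong_AE[OF wdiv_add_scaleR[OF u v] duv _ p])
       (intro fn_subspace_add_scale fn_subspace_L2_space du dv)
  then have "L2_inner \<Omega> p (wdiv \<Omega> (\<lambda>x. u x + t *\<^sub>R v x))
      = L2_inner \<Omega> p (wdiv \<Omega> u) + t * L2_inner \<Omega> p (wdiv \<Omega> v)"
    by (simp add: L2_inner_add_scale_left du dv p L2_inner_commute[of \<Omega> p])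
  moreover have "L2_norm \<Omega> (\<lambda>x. wdiv \<Omega> (\<lambda>x. u x + t *\<^sub>R v x) x - gh x)
      = L2_norm \<Omega> (\<lambda>x. (wdiv \<Omega> u x - gh x) + t * wdiv \<Omega> v x)"
  proof (rule L2_norm_cong_AE)
    show "AE x in M. wdiv \<Omega> (\<lambda>x. u x + t *\<^sub>R v x) x - gh x = (wdiv \<Omega> u x - gh x) + t * wdiv \<Omega> v x"
      using wdiv_add_scaleR[OF u v] by eventually_elim simp
  qed (intro fn_subspace_add_scale fn_subspace_diff fn_subspace_L2_space du dv duv gh)+
  moreover have "(\<lambda>x. wdiv \<Omega> u x - gh x) \<in> L2_space \<Omega>"
    using fn_subspace_L2_space du gh by (rule fn_subspace_diff)
  ultimately show ?thesis
    by (simp add: augmented_Lagrangian_def L2_norm_power2_add_scale dv)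
qed

lemma augmented_Lagrangian_has_derivative:
  assumes u: "u \<in> X_space \<Omega>" and v: "v \<in> X_space \<Omega>" and p: "p \<in> L2_space \<Omega>"
    and gh: "gh \<in> L2_space \<Omega>"
  shows "((\<lambda>t. augmented_Lagrangian \<Omega> F gh \<epsilon> p (\<lambda>x. u x + t *\<^sub>R v x)) has_real_derivative
    DF u v - (LINT x|M. f x \<bullet> v x)
      - L2_inner \<Omega> (\<lambda>x. p x - inverse \<epsilon> * (wdiv \<Omega> u x - gh x)) (wdiv \<Omega> v)) (at 0)"
proof -
  note du = wdiv_is_weak_div(1)[OF u] and dv = wdiv_is_weak_div(1)[OF v]
  have inner_eq: "L2_inner \<Omega> (\<lambda>x. p x - inverse \<epsilon> * (wdiv \<Omega> u x - gh x)) (wdiv \<Omega> v)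
      = L2_inner \<Omega> p (wdiv \<Omega> v) - inverse \<epsilon> * L2_inner \<Omega> (\<lambda>x. wdiv \<Omega> u x - gh x) (wdiv \<Omega> v)"
    using L2_inner_add_scale_left[OF p fn_subspace_diff[OF fn_subspace_L2_space du gh] dv,
        of "- inverse \<epsilon>"]
    by simp
  have half_eq: "1 / (2 * \<epsilon>) * (2 * s) = inverse \<epsilon> * s" for s
    by (cases "\<epsilon> = 0") (simp_all add: field_simps)
  have "((\<lambda>t. augmented_Lagrangian \<Omega> F gh \<epsilon> p (\<lambda>x. u x + t *\<^sub>R v x)) has_real_derivative
      DF u v - (LINT x|M. f x \<bullet> v x) - L2_inner \<Omega> p (wdiv \<Omega> v)
        + 1 / (2 * \<epsilon>) * (2 * L2_inner \<Omega> (\<lambda>x. wdiv \<Omega> u x - gh x) (wdiv \<Omega> v))) (at 0)"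
    unfolding augmented_Lagrangian_on_line[OF assms]
    by (rule derivative_eq_intros DF_energy_has_derivative u v refl | simp)+
  then show ?thesis
    unfolding inner_eq half_eq by (rule DERIV_cong) simp
qed

end

locale discrete_DF = DF_data \<Omega> \<mu> \<rho> \<beta> K f + RT_pair \<Omega> \<T> Xh Mh
  for \<Omega> :: "(real ^ 'd) set" and \<mu> \<rho> \<beta> K f \<T> Xh Mh +
  fixes g gh :: "real ^ 'd \<Rightarrow> real" and uh :: "real ^ 'd \<Rightarrow> real ^ 'd" and ph :: "real ^ 'd \<Rightarrow> real"
  assumes source: "g \<in> L2_space \<Omega>" and projection: "is_L2_projection \<Omega> Mh g gh"
    and solution: "discrete_DF_solution \<Omega> \<mu> \<rho> \<beta> K f g Xh Mh uh ph"
begin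

lemma uh_Xh: "uh \<in> Xh" and ph_Mh: "ph \<in> Mh" and gh_Mh: "gh \<in> Mh"
  using solution projection by (simp_all add: discrete_DF_solution_def is_L2_projection_def)

lemma momentum_equation:
  "v \<in> Xh \<Longrightarrow> DF uh v - (LINT x|M. f x \<bullet> v x) = L2_inner \<Omega> ph (wdiv \<Omega> v)"
  using solution
  by (simp add: discrete_DF_solution_def DF_form_def Darcy_form_def Forchheimer_form_def
      L2_inner_def algebra_simps)

lemma wdiv_uh: "AE x in M. wdiv \<Omega> uh x = gh x"
proof -
  define q where "q x = wdiv \<Omega> uh x - gh x" for x
  have q: "q \<in> Mh"
    unfolding q_def[abs_def] by (intro fn_subspace_diff fn_subspace_Mh wdiv_Xh uh_Xh gh_Mh)
  note L2 = Mh_L2_space[OF q] Mh_L2_space[OF gh_Mh] Mh_L2_space[OF wdiv_Xh[OF uh_Xh]] source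
  have "(L2_norm \<Omega> q)\<^sup>2 = L2_inner \<Omega> (wdiv \<Omega> uh) q - L2_inner \<Omega> gh q"
    unfolding L2_norm_power2 using L2 by (subst (1) q_def[abs_def]) (rule L2_inner_diff_left)
  also have "L2_inner \<Omega> (wdiv \<Omega> uh) q = L2_inner \<Omega> g q"
    using solution q by (simp add: discrete_DF_solution_def L2_inner_def mult.commute)
  also have "L2_inner \<Omega> g q - L2_inner \<Omega> gh q = L2_inner \<Omega> (\<lambda>x. g x - gh x) q"
    using L2 by (simp add: L2_inner_diff_left)
  also have "\<dots> = 0"
    using projection q by (simp add: is_L2_projection_def L2_inner_def)
  finally have "AE x in M. q x = 0"
    using L2_norm_eq_0_iff_AE[OF L2(1)] by simp
  then show ?thesis by (simp add: q_def)
qed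

definition represents_residual :: "(real ^ 'd \<Rightarrow> real ^ 'd) \<Rightarrow> (real ^ 'd \<Rightarrow> real) \<Rightarrow> bool" where
  "represents_residual u e \<longleftrightarrow> (\<forall>v\<in>Xh. DF u v - DF uh v = L2_inner \<Omega> e (wdiv \<Omega> v))"

lemma residual_le_bregman_sym:
  obtains S where "S \<ge> 0"
    and "\<And>u e. u \<in> Xh \<Longrightarrow> e \<in> Mh \<Longrightarrow> represents_residual u e \<Longrightarrow>
      (L2_norm \<Omega> e)\<^sup>2 \<le> S * (bregman_sym F u uh + (bregman_sym F u uh)\<^sup>2)"
proof -
  obtain J :: "((real ^ 'd) set \<times> (real ^ 'd \<Rightarrow> real)) set" and v
    where "finite J" and v: "\<And>j. j \<in> J \<Longrightarrow> v j \<in> Xh"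
      and norm_sum: "\<And>e. e \<in> Mh \<Longrightarrow> (L2_norm \<Omega> e)\<^sup>2 = (\<Sum>j\<in>J. (L2_inner \<Omega> e (wdiv \<Omega> (v j)))\<^sup>2)"
    using Mh_norm_eq_sum_divergences by blast
  have "\<forall>j\<in>J. \<exists>B\<ge>0. \<forall>u\<in>X_space \<Omega>.
      (DF u (v j) - DF uh (v j))\<^sup>2 \<le> B * (bregman_sym F u uh + (bregman_sym F u uh)\<^sup>2)"
    using v by (intro ballI DF_form_diff_le_bregman_sym Xh_X_space uh_Xh)
  from bchoice[OF this] obtain B where B: "\<And>j. j \<in> J \<Longrightarrow> B j \<ge> 0"
      "\<And>j u. j \<in> J \<Longrightarrow> u \<in> X_space \<Omega> \<Longrightarrow>
        (DF u (v j) - DF uh (v j))\<^sup>2 \<le> B j * (bregman_sym F u uh + (bregman_sym F u uh)\<^sup>2)"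
    by blast
  have "(L2_norm \<Omega> e)\<^sup>2 \<le> (\<Sum>j\<in>J. B j) * (bregman_sym F u uh + (bregman_sym F u uh)\<^sup>2)"
    if u: "u \<in> Xh" and e: "e \<in> Mh" and res: "represents_residual u e" for u e
  proof -
    have "(L2_norm \<Omega> e)\<^sup>2 = (\<Sum>j\<in>J. (DF u (v j) - DF uh (v j))\<^sup>2)"
      using norm_sum[OF e] res v by (simp add: represents_residual_def)
    also have "\<dots> \<le> (\<Sum>j\<in>J. B j * (bregman_sym F u uh + (bregman_sym F u uh)\<^sup>2))"
      using B(2) Xh_X_space[OF u] by (intro sum_mono)
    finally show ?thesis by (simp add: sum_distrib_right)
  qed
  moreover have "0 \<le> (\<Sum>j\<in>J. B j)" using B(1) by (rule sum_nonneg)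
  ultimately show thesis by (rule that[rotated])
qed

lemma bounded_residual_le_bregman_sym:
  assumes "R \<ge> 0"
  obtains m where "m > 0"
    and "\<And>u e. u \<in> Xh \<Longrightarrow> e \<in> Mh \<Longrightarrow> represents_residual u e \<Longrightarrow> (L2_norm \<Omega> e)\<^sup>2 \<le> R \<Longrightarrow>
      m * (L2_norm \<Omega> e)\<^sup>2 \<le> bregman_sym F u uh"
proof -
  obtain S where "S \<ge> 0" and residual_bound: "\<And>u e. u \<in> Xh \<Longrightarrow> e \<in> Mh \<Longrightarrow> represents_residual u e \<Longrightarrow>
      (L2_norm \<Omega> e)\<^sup>2 \<le> S * (bregman_sym F u uh + (bregman_sym F u uh)\<^sup>2)"
    using residual_le_bregman_sym by blast
  have "1 / (2 * S + R + 1) * (L2_norm \<Omega> e)\<^sup>2 \<le> bregman_sym F u uh"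
    if u: "u \<in> Xh" and e: "e \<in> Mh" and res: "represents_residual u e"
        and "(L2_norm \<Omega> e)\<^sup>2 \<le> R" for u e
  proof -
    define D where "D = bregman_sym F u uh"
    have "D \<ge> 0"
      unfolding D_def using u uh_Xh by (intro bregman_sym_ge_gaps Xh_X_space)
    have "(L2_norm \<Omega> e)\<^sup>2 \<le> (2 * S + R + 1) * D"
    proof (cases "D \<le> 1")
      case True
      then have "D + D\<^sup>2 \<le> 2 * D"
        using \<open>D \<ge> 0\<close> mult_left_le[of D D] by (simp add: power2_eq_square)
      then have "S * (D + D\<^sup>2) \<le> S * (2 * D)" using \<open>S \<ge> 0\<close> by (rule mult_left_mono)
      moreover have "0 \<le> (R + 1) * D" using \<open>R \<ge> 0\<close> \<open>D \<ge> 0\<close> by simp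
      ultimately show ?thesis
        using residual_bound[OF u e res] by (simp add: D_def algebra_simps)
    next
      case False
      then have "(2 * S + R + 1) * 1 \<le> (2 * S + R + 1) * D"
        using \<open>S \<ge> 0\<close> \<open>R \<ge> 0\<close> by (intro mult_left_mono) auto
      then show ?thesis using \<open>(L2_norm \<Omega> e)\<^sup>2 \<le> R\<close> \<open>S \<ge> 0\<close> by simp
    qed
    then show ?thesis
      using \<open>S \<ge> 0\<close> \<open>R \<ge> 0\<close> by (simp add: D_def divide_simps mult.commute)
  qed
  moreover have "1 / (2 * S + R + 1) > 0" using \<open>S \<ge> 0\<close> \<open>R \<ge> 0\<close> by simp
  ultimately show thesis by (rule that[rotated])
qed

end

locale ALM_iteration = discrete_DF \<Omega> \<mu> \<rho> \<beta> K f \<T> Xh Mh g gh uh ph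
  for \<Omega> :: "(real ^ 'd) set" and \<mu> \<rho> \<beta> K f \<T> Xh Mh g gh uh ph +
  fixes \<epsilon> :: real and p0 :: "real ^ 'd \<Rightarrow> real"
    and u :: "nat \<Rightarrow> real ^ 'd \<Rightarrow> real ^ 'd" and p :: "nat \<Rightarrow> real ^ 'd \<Rightarrow> real"
  assumes penalty_pos: "\<epsilon> > 0" and initial: "p0 \<in> Mh" and ALM: "ALM_sequence \<Omega> F Xh gh \<epsilon> p0 u p"
begin

definition pressure_error :: "nat \<Rightarrow> real ^ 'd \<Rightarrow> real" where
  "pressure_error n x = p n x - ph x"

lemma p_0: "p 0 = p0"
  and u_minimizes: "is_arg_min (augmented_Lagrangian \<Omega> F gh \<epsilon> (p n)) (\<lambda>v. v \<in> Xh) (u (Suc n))"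
  and p_update: "AE x in M. p (Suc n) x = p n x - inverse \<epsilon> * (wdiv \<Omega> (u (Suc n)) x - gh x)"
  using ALM by (auto simp: ALM_sequence_augmented_Lagrangian)

lemma u_Xh: "u (Suc n) \<in> Xh"
  using u_minimizes by (simp add: is_arg_min_def)

lemma updated_pressure_Mh:
  assumes "p n \<in> Mh"
  shows "(\<lambda>x. p n x - inverse \<epsilon> * (wdiv \<Omega> (u (Suc n)) x - gh x)) \<in> Mh"
  using fn_subspace_add_scale[OF fn_subspace_Mh assms
      fn_subspace_diff[OF fn_subspace_Mh wdiv_Xh[OF u_Xh] gh_Mh], of "- inverse \<epsilon>" n]
  by simp

lemma p_Mh: "p n \<in> Mh"
proof (induction n)
  case 0
  then show ?case using initial by (simp add: p_0)
next
  case (Suc n)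
  show ?case
  proof (rule Mh_cong_AE[OF updated_pressure_Mh[OF Suc.IH]])
    show "AE x in M. p n x - inverse \<epsilon> * (wdiv \<Omega> (u (Suc n)) x - gh x) = p (Suc n) x"
      using p_update[of n] by eventually_elim simp
  qed
qed

lemma pressure_error_Mh: "pressure_error n \<in> Mh"
  unfolding pressure_error_def[abs_def] by (intro fn_subspace_diff fn_subspace_Mh p_Mh ph_Mh)

lemma pressure_error_L2: "pressure_error n \<in> L2_space \<Omega>"
  by (intro Mh_L2_space pressure_error_Mh)

lemma optimality:
  assumes v: "v \<in> Xh"
  shows "DF (u (Suc n)) v - (LINT x|M. f x \<bullet> v x) = L2_inner \<Omega> (p (Suc n)) (wdiv \<Omega> v)"
proof -
  define \<Phi> where "\<Phi> t = augmented_Lagrangian \<Omega> F gh \<epsilon> (p n) (\<lambda>x. u (Suc n) x + t *\<^sub>R v x)" for t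
  have min: "\<Phi> 0 \<le> \<Phi> t" for t
    using u_minimizes[of n] fn_subspace_add_scaleR[OF fn_subspace_Xh u_Xh v, of n t]
    by (auto simp: \<Phi>_def is_arg_min_def not_less)
  have "(\<Phi> has_real_derivative DF (u (Suc n)) v - (LINT x|M. f x \<bullet> v x)
      - L2_inner \<Omega> (\<lambda>x. p n x - inverse \<epsilon> * (wdiv \<Omega> (u (Suc n)) x - gh x)) (wdiv \<Omega> v)) (at 0)"
    unfolding \<Phi>_def[abs_def]
    by (intro augmented_Lagrangian_has_derivative Xh_X_space Mh_L2_space u_Xh v p_Mh gh_Mh)
  from DERIV_local_min[OF this, of 1] min have "DF (u (Suc n)) v - (LINT x|M. f x \<bullet> v x)
      = L2_inner \<Omega> (\<lambda>x. p n x - inverse \<epsilon> * (wdiv \<Omega> (u (Suc n)) x - gh x)) (wdiv \<Omega> v)"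
    by simp
  also have "\<dots> = L2_inner \<Omega> (p (Suc n)) (wdiv \<Omega> v)"
    by (rule L2_inner_cong_AE[symmetric, OF p_update])
       (intro Mh_L2_space updated_pressure_Mh p_Mh wdiv_Xh v)+
  finally show ?thesis .
qed

lemma pressure_error_represents_residual:
  "represents_residual (u (Suc n)) (pressure_error (Suc n))"
  unfolding represents_residual_def
proof
  fix v assume v: "v \<in> Xh"
  have "L2_inner \<Omega> (pressure_error (Suc n)) (wdiv \<Omega> v)
      = L2_inner \<Omega> (p (Suc n)) (wdiv \<Omega> v) - L2_inner \<Omega> ph (wdiv \<Omega> v)"
    unfolding pressure_error_def[abs_def]
    using v by (intro L2_inner_diff_left Mh_L2_space p_Mh ph_Mh wdiv_Xh)
  then show "DF (u (Suc n)) v - DF uh v = L2_inner \<Omega> (pressure_error (Suc n)) (wdiv \<Omega> v)"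
    using optimality[OF v, of n] momentum_equation[OF v] by simp
qed

lemma wdiv_velocity_error:
  "AE x in M. wdiv \<Omega> (\<lambda>x. u (Suc n) x - uh x) x
      = \<epsilon> * (pressure_error n x - pressure_error (Suc n) x)"
  using p_update[of n] wdiv_uh wdiv_diff[OF Xh_X_space[OF u_Xh] Xh_X_space[OF uh_Xh], of n]
proof eventually_elim
  case (elim x)
  then show ?case using penalty_pos by (simp add: pressure_error_def)
qed

lemma bregman_sym_iterate:
  "bregman_sym F (u (Suc n)) uh
    = \<epsilon> * (L2_inner \<Omega> (pressure_error n) (pressure_error (Suc n))
        - (L2_norm \<Omega> (pressure_error (Suc n)))\<^sup>2)"
proof -
  note err = pressure_error_L2[of n] pressure_error_L2[of "Suc n"]
  have d: "(\<lambda>x. u (Suc n) x - uh x) \<in> Xh"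
    using fn_subspace_Xh u_Xh uh_Xh by (rule fn_subspace_diff)
  have err_diff: "(\<lambda>x. pressure_error n x - pressure_error (Suc n) x) \<in> L2_space \<Omega>"
    using fn_subspace_L2_space err by (rule fn_subspace_diff)
  have "bregman_sym F (u (Suc n)) uh
      = L2_inner \<Omega> (wdiv \<Omega> (\<lambda>x. u (Suc n) x - uh x)) (pressure_error (Suc n))"
    using pressure_error_represents_residual[of n] d
    by (simp add: represents_residual_def bregman_sym_DF_energy Xh_X_space u_Xh uh_Xh
        L2_inner_commute)
  also have "\<dots> = L2_inner \<Omega> (\<lambda>x. \<epsilon> * (pressure_error n x - pressure_error (Suc n) x))
      (pressure_error (Suc n))"
    by (rule L2_inner_cong_AE[OF wdiv_velocity_error])
       (use fn_subspace_scaleR[OF fn_subspace_L2_space err_diff, of \<epsilon>]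
         in \<open>auto intro: Mh_L2_space wdiv_Xh d pressure_error_L2\<close>)
  also have "\<dots> = \<epsilon> * L2_inner \<Omega> (\<lambda>x. pressure_error n x - pressure_error (Suc n) x)
      (pressure_error (Suc n))"
    by (simp add: L2_inner_def mult.assoc)
  finally show ?thesis
    using err by (simp add: L2_inner_diff_left L2_norm_power2)
qed

lemma pressure_error_inner_le:
  "L2_inner \<Omega> (pressure_error n) (pressure_error (Suc n))
    \<le> L2_norm \<Omega> (pressure_error n) * L2_norm \<Omega> (pressure_error (Suc n))"
  using L2_Cauchy_Schwarz[OF pressure_error_L2 pressure_error_L2]
  by (rule order_trans[OF abs_ge_self])

lemma bregman_sym_le_pressure_error:
  "bregman_sym F (u (Suc n)) uh \<le> \<epsilon> / 4 * (L2_norm \<Omega> (pressure_error n))\<^sup>2"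
proof -
  define s where "s = L2_norm \<Omega> (pressure_error n)"
  define t where "t = L2_norm \<Omega> (pressure_error (Suc n))"
  have "L2_inner \<Omega> (pressure_error n) (pressure_error (Suc n)) - t\<^sup>2 \<le> s * t - t\<^sup>2"
    using pressure_error_inner_le by (simp add: s_def t_def)
  also have "\<dots> = s\<^sup>2 / 4 - (s / 2 - t)\<^sup>2"
    by (simp add: power2_eq_square field_simps)
  also have "\<dots> \<le> s\<^sup>2 / 4" by simp
  finally have "\<epsilon> * (L2_inner \<Omega> (pressure_error n) (pressure_error (Suc n)) - t\<^sup>2) \<le> \<epsilon> * (s\<^sup>2 / 4)"
    using penalty_pos by (intro mult_left_mono) auto
  then show ?thesis by (simp add: bregman_sym_iterate s_def t_def)
qed

lemma pressure_error_contraction: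
  assumes "k \<ge> 0" and k: "k * (L2_norm \<Omega> (pressure_error (Suc n)))\<^sup>2 \<le> bregman_sym F (u (Suc n)) uh"
  shows "L2_norm \<Omega> (pressure_error (Suc n)) \<le> \<epsilon> / (k + \<epsilon>) * L2_norm \<Omega> (pressure_error n)"
proof -
  define s where "s = L2_norm \<Omega> (pressure_error n)"
  define t where "t = L2_norm \<Omega> (pressure_error (Suc n))"
  have "s \<ge> 0" "t \<ge> 0" by (simp_all add: s_def t_def L2_norm_nonneg)
  have "k * t\<^sup>2 \<le> \<epsilon> * (s * t - t\<^sup>2)"
    using k mult_left_mono[OF pressure_error_inner_le[of n] less_imp_le[OF penalty_pos]]
    by (simp add: bregman_sym_iterate s_def t_def algebra_simps)
  then have "(k + \<epsilon>) * t * t \<le> \<epsilon> * s * t"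
    by (simp add: power2_eq_square algebra_simps)
  then have "(k + \<epsilon>) * t \<le> \<epsilon> * s"
    using \<open>s \<ge> 0\<close> \<open>t \<ge> 0\<close> penalty_pos by (cases "t = 0") auto
  then show ?thesis
    using \<open>k \<ge> 0\<close> penalty_pos by (simp add: s_def t_def field_simps)
qed

lemma pressure_error_decreasing: "L2_norm \<Omega> (pressure_error n) \<le> L2_norm \<Omega> (pressure_error 0)"
proof (induction n)
  case (Suc n)
  have "L2_norm \<Omega> (pressure_error (Suc n)) \<le> L2_norm \<Omega> (pressure_error n)"
    using pressure_error_contraction[of 0 n] penalty_pos
    by (simp add: bregman_sym_ge_gaps Xh_X_space u_Xh uh_Xh)
  then show ?case using Suc.IH by linarith
qed simp

lemma pressure_error_linear_rate:
  assumes "m > 0"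
    and "\<And>n. m * (L2_norm \<Omega> (pressure_error (Suc n)))\<^sup>2 \<le> bregman_sym F (u (Suc n)) uh"
  shows "(L2_norm \<Omega> (pressure_error n))\<^sup>2
      \<le> (\<epsilon> / (m + \<epsilon>)) ^ (2 * n) * (L2_norm \<Omega> (pressure_error 0))\<^sup>2"
proof -
  have "L2_norm \<Omega> (pressure_error n) \<le> (\<epsilon> / (m + \<epsilon>)) ^ n * L2_norm \<Omega> (pressure_error 0)"
  proof (induction n)
    case (Suc n)
    have "L2_norm \<Omega> (pressure_error (Suc n)) \<le> \<epsilon> / (m + \<epsilon>) * L2_norm \<Omega> (pressure_error n)"
      using assms by (intro pressure_error_contraction) auto
    also have "\<dots> \<le> \<epsilon> / (m + \<epsilon>) * ((\<epsilon> / (m + \<epsilon>)) ^ n * L2_norm \<Omega> (pressure_error 0))"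
      using \<open>m > 0\<close> penalty_pos Suc.IH by (intro mult_left_mono) auto
    finally show ?case by simp
  qed simp
  then have "(L2_norm \<Omega> (pressure_error n))\<^sup>2
      \<le> ((\<epsilon> / (m + \<epsilon>)) ^ n * L2_norm \<Omega> (pressure_error 0))\<^sup>2"
    using L2_norm_nonneg by (rule power_mono)
  then show ?thesis by (simp add: power_mult_distrib power_even_eq)
qed

end

theorem theorem3p1:
  fixes \<Omega> :: "(real ^ 'd) set"
    and \<T> :: "(real ^ 'd) set set"
    and \<sigma> \<mu> \<rho> \<beta> :: real
    and K :: "real ^ 'd \<Rightarrow> real ^ 'd ^ 'd"
    and f :: "real ^ 'd \<Rightarrow> real ^ 'd"
    and g gh :: "real ^ 'd \<Rightarrow> real"
    and Xh :: "(real ^ 'd \<Rightarrow> real ^ 'd) set"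
    and Mh :: "(real ^ 'd \<Rightarrow> real) set"
    and uh :: "real ^ 'd \<Rightarrow> real ^ 'd"
    and ph p0 :: "real ^ 'd \<Rightarrow> real"
  assumes "CARD('d) = 2 \<or> CARD('d) = 3"
    and "bounded \<Omega>" and "polyhedral_domain \<Omega>"
    and "\<mu> > 0" and "\<rho> > 0" and "\<beta> \<ge> 0"
    and "permeability_tensor \<Omega> K"
    and "bounded_load \<Omega> f"
    and "g \<in> L2_space \<Omega>"
    and "partition_of_domain \<Omega> \<T>" and "quasi_uniform \<sigma> \<T>"
    and "RT_type_pair \<Omega> \<T> Xh Mh"
    and "is_L2_projection \<Omega> Mh g gh"
    and "discrete_DF_solution \<Omega> \<mu> \<rho> \<beta> K f g Xh Mh uh ph"
    and "p0 \<in> Mh"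
  shows "\<exists>mu_star>0. \<forall>\<epsilon>>0. \<forall>u p.
           ALM_sequence \<Omega> (DF_energy \<Omega> \<mu> \<rho> \<beta> K f) Xh gh \<epsilon> p0 u p \<longrightarrow>
           (\<forall>n. bregman_sym (DF_energy \<Omega> \<mu> \<rho> \<beta> K f) (u (Suc n)) uh
                  \<le> \<epsilon> / 4 * (L2_norm \<Omega> (\<lambda>x. p n x - ph x))\<^sup>2 \<and>
                \<epsilon> / 4 * (L2_norm \<Omega> (\<lambda>x. p n x - ph x))\<^sup>2
                  \<le> \<epsilon> / 4 * (\<epsilon> / (mu_star + \<epsilon>)) ^ (2 * n) * (L2_norm \<Omega> (\<lambda>x. p0 x - ph x))\<^sup>2)"
proof -
  interpret discrete_DF \<Omega> \<mu> \<rho> \<beta> K f \<T> Xh Mh g gh uh ph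
    using assms by unfold_locales (auto simp: polyhedral_domain_def)
  obtain m where "m > 0" and error_bound: "\<And>u e. u \<in> Xh \<Longrightarrow> e \<in> Mh \<Longrightarrow> represents_residual u e \<Longrightarrow>
      (L2_norm \<Omega> e)\<^sup>2 \<le> (L2_norm \<Omega> (\<lambda>x. p0 x - ph x))\<^sup>2 \<Longrightarrow> m * (L2_norm \<Omega> e)\<^sup>2 \<le> bregman_sym F u uh"
    using bounded_residual_le_bregman_sym[OF zero_le_power2] by blast
  show ?thesis
  proof (intro exI[of _ m] conjI allI impI)
    fix \<epsilon> :: real and u p n
    assume "\<epsilon> > 0" and "ALM_sequence \<Omega> F Xh gh \<epsilon> p0 u p"
    then interpret ALM_iteration \<Omega> \<mu> \<rho> \<beta> K f \<T> Xh Mh g gh uh ph \<epsilon> p0 u p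
      using assms by unfold_locales
    have error: "pressure_error 0 = (\<lambda>x. p0 x - ph x)" "pressure_error n = (\<lambda>x. p n x - ph x)"
      by (simp_all add: pressure_error_def[abs_def] p_0)
    show "bregman_sym F (u (Suc n)) uh \<le> \<epsilon> / 4 * (L2_norm \<Omega> (\<lambda>x. p n x - ph x))\<^sup>2"
      using bregman_sym_le_pressure_error[of n] by (simp only: error)
    have "m * (L2_norm \<Omega> (pressure_error (Suc k)))\<^sup>2 \<le> bregman_sym F (u (Suc k)) uh" for k
      using pressure_error_decreasing[unfolded error]
      by (intro error_bound u_Xh pressure_error_Mh pressure_error_represents_residual power_mono
          L2_norm_nonneg)
    from pressure_error_linear_rate[OF \<open>m > 0\<close> this, of n]
    show "\<epsilon> / 4 * (L2_norm \<Omega> (\<lambda>x. p n x - ph x))\<^sup>2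
        \<le> \<epsilon> / 4 * (\<epsilon> / (m + \<epsilon>)) ^ (2 * n) * (L2_norm \<Omega> (\<lambda>x. p0 x - ph x))\<^sup>2"
      using \<open>\<epsilon> > 0\<close> by (simp add: error mult.assoc mult_left_mono)
  qed fact
qed

end
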